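(* Let $k$ be a field, let $X\subseteq k$ be a subset, let $Z\subseteq X\times X$, and let $\varphi:Z\to X$ be given by $\varphi(x,z)=z$. Let $A$ be a finite-dimensional associative unital $k$-algebra. (i) The function $R':X\to\mathrm{End}_k(A\otimes A)$ defined by $$R'(x)(a\otimes b)=x\,1\otimes ab+ab\otimes 1-b\otimes a\qquad (a,b\in A)$$ is a one-parameter Yang-Baxter operator (with respect to $\varphi(x,z)=z$). (ii) If $x\in X$ and $x\neq 0$, then the operator $R'(x)$ is invertible, and for all $a,b\in A$ $$R'^{-1}(x)(a\otimes b)=ba\otimes 1+\frac{1}{x}\,1\otimes ba-b\otimes a ,$$ where $R'^{-1}(x)$ denotes the inverse of the linear operator $R'(x)$.
   Context: All tensor products are over $k$. Let $X$ be a set, $Z\subseteq X\times X$, $\varphi:Z\to X$ a map, and $V$ a finite-dimensional $k$-vector space. A function $R:X\to\mathrm{End}_k(V\otimes V)$ is called a one-parameter Yang-Baxter operator (with respect to $\varphi$) if $$R_{12}(x)R_{13}(\varphi(x,z))R_{23}(z)=R_{23}(z)R_{13}(\varphi(x,z))R_{12}(x)\quad\text{for all }(x,z)\in Z,$$ as operators on $V\otimes V\otimes V$, where for $y\in X$, $R_{12}(y)=R(y)\otimes\mathrm{id}_V$, $R_{23}(y)=\mathrm{id}_V\otimes R(y)$, and $R_{13}(y)$ acts as $R(y)$ on the first and third tensor factors and trivially on the second. *)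

theory Defs
  imports "Jordan_Normal_Form.Missing_VectorSpace" "HOL-Algebra.AbelCoset"
begin

section \<open>Tensor products\<close>

text \<open>
  The tensor product of two modules is the standard one: the free module on pairs, modulo the
  submodule spanned by the bilinearity relations.  Only the module structure of these records
  matters; their ring fields \<open>mult\<close> and \<open>one\<close> are left unspecified.
\<close>

definition free_mod :: "('k, 'm) ring_scheme \<Rightarrow> 's set \<Rightarrow> ('k, 's \<Rightarrow> 'k) module" where
  "free_mod K S =
     \<lparr>carrier = {f \<in> S \<rightarrow>\<^sub>E carrier K. finite {s \<in> S. f s \<noteq> \<zero>\<^bsub>K\<^esub>}},
      monoid.mult = undefined, one = undefined,
      zero = (\<lambda>s\<in>S. \<zero>\<^bsub>K\<^esub>), add = (\<lambda>f g. \<lambda>s\<in>S. f s \<oplus>\<^bsub>K\<^esub> g s),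
      smult = (\<lambda>c f. \<lambda>s\<in>S. c \<otimes>\<^bsub>K\<^esub> f s)\<rparr>"

definition free_gen :: "('k, 'm) ring_scheme \<Rightarrow> 's set \<Rightarrow> 's \<Rightarrow> 's \<Rightarrow> 'k" where
  "free_gen K S s = (\<lambda>t\<in>S. if t = s then \<one>\<^bsub>K\<^esub> else \<zero>\<^bsub>K\<^esub>)"

definition quot_mod :: "('k, 'v, 'm) module_scheme \<Rightarrow> 'v set \<Rightarrow> ('k, 'v set) module" where
  "quot_mod M N =
     \<lparr>carrier = a_rcosets\<^bsub>M\<^esub> N, monoid.mult = undefined, one = undefined,
      zero = N, add = (\<lambda>C D. C <+>\<^bsub>M\<^esub> D),
      smult = (\<lambda>c C. \<Union>v\<in>C. N +>\<^bsub>M\<^esub> (c \<odot>\<^bsub>M\<^esub> v))\<rparr>"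

definition bilinear_relations ::
  "('k, 'm) ring_scheme \<Rightarrow> ('k, 'v, 'n) module_scheme \<Rightarrow> ('k, 'w, 'p) module_scheme
    \<Rightarrow> ('v \<times> 'w \<Rightarrow> 'k) set" where
  "bilinear_relations K V W =
     (let F = free_mod K (carrier V \<times> carrier W); g = free_gen K (carrier V \<times> carrier W) in
       {g (v \<oplus>\<^bsub>V\<^esub> v', w) \<ominus>\<^bsub>F\<^esub> (g (v, w) \<oplus>\<^bsub>F\<^esub> g (v', w)) |v v' w.
          v \<in> carrier V \<and> v' \<in> carrier V \<and> w \<in> carrier W} \<union>
       {g (v, w \<oplus>\<^bsub>W\<^esub> w') \<ominus>\<^bsub>F\<^esub> (g (v, w) \<oplus>\<^bsub>F\<^esub> g (v, w')) |v w w'.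
          v \<in> carrier V \<and> w \<in> carrier W \<and> w' \<in> carrier W} \<union>
       {g (c \<odot>\<^bsub>V\<^esub> v, w) \<ominus>\<^bsub>F\<^esub> c \<odot>\<^bsub>F\<^esub> g (v, w) |c v w.
          c \<in> carrier K \<and> v \<in> carrier V \<and> w \<in> carrier W} \<union>
       {g (v, c \<odot>\<^bsub>W\<^esub> w) \<ominus>\<^bsub>F\<^esub> c \<odot>\<^bsub>F\<^esub> g (v, w) |c v w.
          c \<in> carrier K \<and> v \<in> carrier V \<and> w \<in> carrier W})"

definition tensor_kernel ::
  "('k, 'm) ring_scheme \<Rightarrow> ('k, 'v, 'n) module_scheme \<Rightarrow> ('k, 'w, 'p) module_scheme
    \<Rightarrow> ('v \<times> 'w \<Rightarrow> 'k) set" where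
  "tensor_kernel K V W =
     module.span K (free_mod K (carrier V \<times> carrier W)) (bilinear_relations K V W)"

definition tensor ::
  "('k, 'm) ring_scheme \<Rightarrow> ('k, 'v, 'n) module_scheme \<Rightarrow> ('k, 'w, 'p) module_scheme
    \<Rightarrow> ('k, ('v \<times> 'w \<Rightarrow> 'k) set) module" where
  "tensor K V W = quot_mod (free_mod K (carrier V \<times> carrier W)) (tensor_kernel K V W)"

definition tens ::
  "('k, 'm) ring_scheme \<Rightarrow> ('k, 'v, 'n) module_scheme \<Rightarrow> ('k, 'w, 'p) module_scheme
    \<Rightarrow> 'v \<Rightarrow> 'w \<Rightarrow> ('v \<times> 'w \<Rightarrow> 'k) set" where
  "tens K V W v w =
     tensor_kernel K V W +>\<^bsub>free_mod K (carrier V \<times> carrier W)\<^esub>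
       free_gen K (carrier V \<times> carrier W) (v, w)"

text \<open>
  The linear map \<open>V \<otimes> W \<rightarrow> U\<close> induced by a bilinear map \<open>\<beta>\<close>, made unique as a HOL function by
  being \<^term>\<open>undefined\<close> outside \<open>V \<otimes> W\<close>.
\<close>

definition tensor_lift ::
  "('k, 'm) ring_scheme \<Rightarrow> ('k, 'v, 'n) module_scheme \<Rightarrow> ('k, 'w, 'p) module_scheme
    \<Rightarrow> ('k, 'u, 'q) module_scheme \<Rightarrow> ('v \<Rightarrow> 'w \<Rightarrow> 'u) \<Rightarrow> ('v \<times> 'w \<Rightarrow> 'k) set \<Rightarrow> 'u" where
  "tensor_lift K V W U \<beta> =
     (THE h. h \<in> module_hom K (tensor K V W) U \<inter> extensional (carrier (tensor K V W)) \<and>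
        (\<forall>v\<in>carrier V. \<forall>w\<in>carrier W. h (tens K V W v w) = \<beta> v w))"

subsection \<open>The universal property\<close>

text \<open>
  \<open>tensor_lift_universal\<close> below shows that the description defining \<^const>\<open>tensor_lift\<close> is
  satisfied by exactly one function whenever \<open>\<beta>\<close> is bilinear.
\<close>

lemma free_mod_carrier:
  "f \<in> carrier (free_mod K S) \<longleftrightarrow>
     (\<forall>s\<in>S. f s \<in> carrier K) \<and> f \<in> extensional S \<and> finite {s \<in> S. f s \<noteq> \<zero>\<^bsub>K\<^esub>}"
  by (auto simp: free_mod_def PiE_def)

lemma free_mod_add: "(f \<oplus>\<^bsub>free_mod K S\<^esub> g) = (\<lambda>s\<in>S. f s \<oplus>\<^bsub>K\<^esub> g s)"
  and free_mod_smult: "(c \<odot>\<^bsub>free_mod K S\<^esub> f) = (\<lambda>s\<in>S. c \<otimes>\<^bsub>K\<^esub> f s)"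
  and free_mod_zero: "\<zero>\<^bsub>free_mod K S\<^esub> = (\<lambda>s\<in>S. \<zero>\<^bsub>K\<^esub>)"
  by (simp_all add: free_mod_def)

lemma free_mod_module:
  assumes "field K" shows "module K (free_mod K S)"
proof -
  interpret K: field K by fact
  let ?F = "free_mod K S"
  note defs = free_mod_add free_mod_smult free_mod_zero
  have mem: "f s \<in> carrier K" if "f \<in> carrier ?F" "s \<in> S" for f s
    using that by (simp add: free_mod_carrier)
  have ext: "f \<in> extensional S" if "f \<in> carrier ?F" for f
    using that by (simp add: free_mod_carrier)
  have fin: "finite {s \<in> S. f s \<noteq> \<zero>\<^bsub>K\<^esub>}" if "f \<in> carrier ?F" for f
    using that by (simp add: free_mod_carrier)
  have I: "f \<in> carrier ?F" if "\<And>s. s \<in> S \<Longrightarrow> f s \<in> carrier K" "f \<in> extensional S"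
      "finite B" "\<And>s. s \<in> S \<Longrightarrow> s \<notin> B \<Longrightarrow> f s = \<zero>\<^bsub>K\<^esub>" for f B
  proof -
    have "{s \<in> S. f s \<noteq> \<zero>\<^bsub>K\<^esub>} \<subseteq> B" using that(4) by blast
    then have "finite {s \<in> S. f s \<noteq> \<zero>\<^bsub>K\<^esub>}" using that(3) finite_subset by blast
    then show ?thesis using that(1,2) by (simp add: free_mod_carrier)
  qed
  have eqI: "f = g" if "f \<in> extensional S" "g \<in> extensional S" "\<And>s. s \<in> S \<Longrightarrow> f s = g s" for f g
    using that by (rule extensionalityI)
  have add: "f \<oplus>\<^bsub>?F\<^esub> g \<in> carrier ?F" if "f \<in> carrier ?F" "g \<in> carrier ?F" for f g
    by (rule I[of _ "{s \<in> S. f s \<noteq> \<zero>\<^bsub>K\<^esub>} \<union> {s \<in> S. g s \<noteq> \<zero>\<^bsub>K\<^esub>}"])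
       (use that in \<open>auto simp: defs mem fin\<close>)
  have smult: "c \<odot>\<^bsub>?F\<^esub> f \<in> carrier ?F" if "c \<in> carrier K" "f \<in> carrier ?F" for c f
    by (rule I[of _ "{s \<in> S. f s \<noteq> \<zero>\<^bsub>K\<^esub>}"]) (use that in \<open>auto simp: defs mem fin\<close>)
  have zero: "\<zero>\<^bsub>?F\<^esub> \<in> carrier ?F"
    by (rule I[of _ "{}"]) (auto simp: defs)
  have ag: "abelian_group ?F"
  proof (rule abelian_groupI)
    fix f assume f: "f \<in> carrier ?F"
    have "(\<lambda>s\<in>S. \<ominus>\<^bsub>K\<^esub> f s) \<in> carrier ?F"
      by (rule I[of _ "{s \<in> S. f s \<noteq> \<zero>\<^bsub>K\<^esub>}"]) (use f in \<open>auto simp: mem fin\<close>)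
    moreover have "(\<lambda>s\<in>S. \<ominus>\<^bsub>K\<^esub> f s) \<oplus>\<^bsub>?F\<^esub> f = \<zero>\<^bsub>?F\<^esub>"
      by (rule eqI) (use f in \<open>simp_all add: defs mem K.l_neg\<close>)
    ultimately show "\<exists>g\<in>carrier ?F. g \<oplus>\<^bsub>?F\<^esub> f = \<zero>\<^bsub>?F\<^esub>" by blast
    show "\<zero>\<^bsub>?F\<^esub> \<oplus>\<^bsub>?F\<^esub> f = f"
      by (rule eqI) (use f ext in \<open>simp_all add: defs mem\<close>)
  next
    fix f g assume "f \<in> carrier ?F" "g \<in> carrier ?F"
    then show "f \<oplus>\<^bsub>?F\<^esub> g = g \<oplus>\<^bsub>?F\<^esub> f"
      by (intro eqI) (simp_all add: defs mem K.a_comm)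
  next
    fix f g h assume "f \<in> carrier ?F" "g \<in> carrier ?F" "h \<in> carrier ?F"
    then show "f \<oplus>\<^bsub>?F\<^esub> g \<oplus>\<^bsub>?F\<^esub> h = f \<oplus>\<^bsub>?F\<^esub> (g \<oplus>\<^bsub>?F\<^esub> h)"
      by (intro eqI) (simp_all add: defs mem K.a_assoc)
  qed (use add zero in auto)
  show ?thesis
  proof (rule moduleI[OF K.is_cring ag])
    fix c d f assume "c \<in> carrier K" "d \<in> carrier K" "f \<in> carrier ?F"
    then show "(c \<oplus>\<^bsub>K\<^esub> d) \<odot>\<^bsub>?F\<^esub> f = c \<odot>\<^bsub>?F\<^esub> f \<oplus>\<^bsub>?F\<^esub> d \<odot>\<^bsub>?F\<^esub> f"
      by (intro eqI) (simp_all add: defs mem K.l_distr)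
  next
    fix c f g assume "c \<in> carrier K" "f \<in> carrier ?F" "g \<in> carrier ?F"
    then show "c \<odot>\<^bsub>?F\<^esub> (f \<oplus>\<^bsub>?F\<^esub> g) = c \<odot>\<^bsub>?F\<^esub> f \<oplus>\<^bsub>?F\<^esub> c \<odot>\<^bsub>?F\<^esub> g"
      by (intro eqI) (simp_all add: defs mem K.r_distr)
  next
    fix c d f assume "c \<in> carrier K" "d \<in> carrier K" "f \<in> carrier ?F"
    then show "(c \<otimes>\<^bsub>K\<^esub> d) \<odot>\<^bsub>?F\<^esub> f = c \<odot>\<^bsub>?F\<^esub> (d \<odot>\<^bsub>?F\<^esub> f)"
      by (intro eqI) (simp_all add: defs mem K.m_assoc)
  next
    fix f assume "f \<in> carrier ?F"
    then show "\<one>\<^bsub>K\<^esub> \<odot>\<^bsub>?F\<^esub> f = f"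
      by (intro eqI) (simp_all add: defs mem ext)
  qed (use smult in auto)
qed

lemma free_gen_closed:
  assumes "field K" "s \<in> S" shows "free_gen K S s \<in> carrier (free_mod K S)"
proof -
  interpret K: field K by fact
  have "finite {t \<in> S. free_gen K S s t \<noteq> \<zero>\<^bsub>K\<^esub>}"
    by (rule finite_subset[of _ "{s}"]) (auto simp: free_gen_def)
  then show ?thesis by (auto simp: free_mod_def free_gen_def cong: conj_cong)
qed

lemma submodule_abelian_subgroup:
  assumes "module K M" "submodule K N M" shows "abelian_subgroup N M"
proof -
  interpret M: module K M by fact
  interpret N: submodule K N M by fact
  have N0: "\<zero>\<^bsub>M\<^esub> \<in> N" using assms(2) by (simp add: submodule_def)
  have neg: "\<ominus>\<^bsub>M\<^esub> n \<in> N" if "n \<in> N" for n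
  proof -
    have "n \<in> carrier M" using that N.subset by auto
    then have "\<ominus>\<^bsub>M\<^esub> n = (\<ominus>\<^bsub>K\<^esub> \<one>\<^bsub>K\<^esub>) \<odot>\<^bsub>M\<^esub> n" by (simp add: M.smult_l_minus)
    then show ?thesis using N.smult_closed[OF _ that] by simp
  qed
  show ?thesis
  proof (rule abelian_subgroupI3)
    show "additive_subgroup N M"
    proof (rule additive_subgroup.intro, rule M.add.subgroupI)
      show "N \<subseteq> carrier M" by (rule N.subset)
      show "N \<noteq> {}" by (metis N0 empty_iff)
      fix a assume a: "a \<in> N"
      show "\<ominus>\<^bsub>M\<^esub> a \<in> N" using neg[OF a] .
    next
      fix a b assume "a \<in> N" "b \<in> N"
      then show "a \<oplus>\<^bsub>M\<^esub> b \<in> N" using N.m_closed by simp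
    qed
    show "abelian_group M" by unfold_locales
  qed
qed

lemma quot_mod_props:
  assumes "module K M" "submodule K N M"
  shows quot_mod_module: "module K (quot_mod M N)"
    and quot_mod_smult: "\<And>c v. c \<in> carrier K \<Longrightarrow> v \<in> carrier M \<Longrightarrow>
        c \<odot>\<^bsub>quot_mod M N\<^esub> (N +>\<^bsub>M\<^esub> v) = N +>\<^bsub>M\<^esub> (c \<odot>\<^bsub>M\<^esub> v)"
    and quot_mod_add: "\<And>v w. v \<in> carrier M \<Longrightarrow> w \<in> carrier M \<Longrightarrow>
        (N +>\<^bsub>M\<^esub> v) \<oplus>\<^bsub>quot_mod M N\<^esub> (N +>\<^bsub>M\<^esub> w) = N +>\<^bsub>M\<^esub> (v \<oplus>\<^bsub>M\<^esub> w)"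
    and quot_mod_carrier: "carrier (quot_mod M N) = (\<lambda>v. N +>\<^bsub>M\<^esub> v) ` carrier M"
    and quot_eq_zero: "\<And>v. v \<in> carrier M \<Longrightarrow> N +>\<^bsub>M\<^esub> v = N \<longleftrightarrow> v \<in> N"
proof -
  interpret M: module K M by fact
  interpret N: submodule K N M by fact
  interpret S: abelian_subgroup N M by (rule submodule_abelian_subgroup[OF assms])
  have N0: "\<zero>\<^bsub>M\<^esub> \<in> N" using assms(2) by (simp add: submodule_def)
  show carr: "carrier (quot_mod M N) = (\<lambda>v. N +>\<^bsub>M\<^esub> v) ` carrier M"
    by (auto simp: quot_mod_def A_RCOSETS_def RCOSETS_def a_r_coset_def)
  show add: "(N +>\<^bsub>M\<^esub> v) \<oplus>\<^bsub>quot_mod M N\<^esub> (N +>\<^bsub>M\<^esub> w) = N +>\<^bsub>M\<^esub> (v \<oplus>\<^bsub>M\<^esub> w)"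
    if "v \<in> carrier M" "w \<in> carrier M" for v w
    using that by (simp add: quot_mod_def S.a_rcos_sum)
  show zero: "N +>\<^bsub>M\<^esub> v = N \<longleftrightarrow> v \<in> N" if "v \<in> carrier M" for v
    using that S.a_rcos_const S.a_rcos_self by metis
  show smult: "c \<odot>\<^bsub>quot_mod M N\<^esub> (N +>\<^bsub>M\<^esub> v) = N +>\<^bsub>M\<^esub> (c \<odot>\<^bsub>M\<^esub> v)"
    if c: "c \<in> carrier K" and v: "v \<in> carrier M" for c v
  proof -
    have *: "N +>\<^bsub>M\<^esub> (c \<odot>\<^bsub>M\<^esub> w) = N +>\<^bsub>M\<^esub> (c \<odot>\<^bsub>M\<^esub> v)" if "w \<in> N +>\<^bsub>M\<^esub> v" for w
    proof -
      from that obtain n where n: "n \<in> N" "w = n \<oplus>\<^bsub>M\<^esub> v"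
        by (auto simp: a_r_coset_def r_coset_def)
      have nM: "n \<in> carrier M" using n N.subset by auto
      have "c \<odot>\<^bsub>M\<^esub> w = (c \<odot>\<^bsub>M\<^esub> n) \<oplus>\<^bsub>M\<^esub> (c \<odot>\<^bsub>M\<^esub> v)"
        using n nM c v by (simp add: M.smult_r_distr)
      moreover have "c \<odot>\<^bsub>M\<^esub> n \<in> N" using N.smult_closed c n by simp
      ultimately show ?thesis
        using add[of "c \<odot>\<^bsub>M\<^esub> n" "c \<odot>\<^bsub>M\<^esub> v"] add[of "\<zero>\<^bsub>M\<^esub>" "c \<odot>\<^bsub>M\<^esub> v"]
          zero[of "c \<odot>\<^bsub>M\<^esub> n"] zero[of "\<zero>\<^bsub>M\<^esub>"] c v nM N0 by simp
    qed
    have "v \<in> N +>\<^bsub>M\<^esub> v" using v by (rule S.a_rcos_self)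
    then have "(\<Union>w\<in>N +>\<^bsub>M\<^esub> v. N +>\<^bsub>M\<^esub> (c \<odot>\<^bsub>M\<^esub> w)) = N +>\<^bsub>M\<^esub> (c \<odot>\<^bsub>M\<^esub> v)"
      by (rule UN_constant_eq) (intro ballI, erule *)
    then show ?thesis by (simp add: quot_mod_def)
  qed
  have qzero: "\<zero>\<^bsub>quot_mod M N\<^esub> = N +>\<^bsub>M\<^esub> \<zero>\<^bsub>M\<^esub>"
    using zero[of "\<zero>\<^bsub>M\<^esub>"] N0 by (simp add: quot_mod_def)
  have ag: "abelian_group (quot_mod M N)"
  proof (rule abelian_groupI)
    fix C assume "C \<in> carrier (quot_mod M N)"
    then obtain v where v: "v \<in> carrier M" "C = N +>\<^bsub>M\<^esub> v" unfolding carr by blast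
    then have "N +>\<^bsub>M\<^esub> (\<ominus>\<^bsub>M\<^esub> v) \<in> carrier (quot_mod M N)" unfolding carr by simp
    moreover have "(N +>\<^bsub>M\<^esub> (\<ominus>\<^bsub>M\<^esub> v)) \<oplus>\<^bsub>quot_mod M N\<^esub> C = \<zero>\<^bsub>quot_mod M N\<^esub>"
      using v by (simp add: add qzero M.l_neg)
    ultimately show "\<exists>D\<in>carrier (quot_mod M N). D \<oplus>\<^bsub>quot_mod M N\<^esub> C = \<zero>\<^bsub>quot_mod M N\<^esub>" by blast
  qed (auto simp: carr add qzero M.a_ac)
  show "module K (quot_mod M N)"
    by (rule moduleI[OF M.is_cring ag])
       (auto simp: carr smult add M.smult_l_distr M.smult_r_distr M.smult_assoc1)
qed

lemma free_mod_decomp: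
  assumes "field K" "f \<in> carrier (free_mod K S)" "s \<in> S" "f s \<noteq> \<zero>\<^bsub>K\<^esub>"
  shows "\<exists>f'\<in>carrier (free_mod K S). f = (f s \<odot>\<^bsub>free_mod K S\<^esub> free_gen K S s) \<oplus>\<^bsub>free_mod K S\<^esub> f'
     \<and> {t\<in>S. f' t \<noteq> \<zero>\<^bsub>K\<^esub>} = {t\<in>S. f t \<noteq> \<zero>\<^bsub>K\<^esub>} - {s}"
proof -
  interpret K: field K by fact
  define f' where "f' = (\<lambda>t\<in>S. if t = s then \<zero>\<^bsub>K\<^esub> else f t)"
  have supp: "{t\<in>S. f' t \<noteq> \<zero>\<^bsub>K\<^esub>} = {t\<in>S. f t \<noteq> \<zero>\<^bsub>K\<^esub>} - {s}" by (auto simp: f'_def)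
  have "finite {t\<in>S. f t \<noteq> \<zero>\<^bsub>K\<^esub>}" using assms(2) by (simp add: free_mod_def)
  then have "finite {t\<in>S. f' t \<noteq> \<zero>\<^bsub>K\<^esub>}" by (simp add: supp)
  moreover have "f' \<in> S \<rightarrow>\<^sub>E carrier K" using assms(2) by (auto simp: f'_def free_mod_def)
  ultimately have "f' \<in> carrier (free_mod K S)" by (simp add: free_mod_def)
  moreover have "f = (f s \<odot>\<^bsub>free_mod K S\<^esub> free_gen K S s) \<oplus>\<^bsub>free_mod K S\<^esub> f'"
  proof
    fix t
    have f: "f \<in> S \<rightarrow>\<^sub>E carrier K" using assms(2) by (simp add: free_mod_def)
    show "f t = ((f s \<odot>\<^bsub>free_mod K S\<^esub> free_gen K S s) \<oplus>\<^bsub>free_mod K S\<^esub> f') t"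
      using PiE_mem[OF f] PiE_arb[OF f] assms(3) by (auto simp: free_mod_def free_gen_def f'_def)
  qed
  ultimately show ?thesis using supp by blast
qed

lemma free_hom_unique:
  assumes "field K" "module K P"
    and "\<Phi> \<in> module_hom K (free_mod K S) P" "\<Psi> \<in> module_hom K (free_mod K S) P"
    and eq: "\<And>s. s \<in> S \<Longrightarrow> \<Phi> (free_gen K S s) = \<Psi> (free_gen K S s)"
    and "f \<in> carrier (free_mod K S)"
  shows "\<Phi> f = \<Psi> f"
  using assms(6)
proof (induction "card {t\<in>S. f t \<noteq> \<zero>\<^bsub>K\<^esub>}" arbitrary: f)
  case 0
  interpret K: field K by fact
  interpret A: mod_hom K "free_mod K S" P \<Phi>
    using assms free_mod_module by (simp add: mod_hom_def mod_hom_axioms_def)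
  interpret B: mod_hom K "free_mod K S" P \<Psi>
    using assms free_mod_module by (simp add: mod_hom_def mod_hom_axioms_def)
  from 0 have "{t\<in>S. f t \<noteq> \<zero>\<^bsub>K\<^esub>} = {}" by (simp add: free_mod_def)
  moreover have f: "f \<in> S \<rightarrow>\<^sub>E carrier K" using 0 by (simp add: free_mod_def)
  ultimately have "f = \<zero>\<^bsub>free_mod K S\<^esub>"
    using PiE_arb[OF f] by (auto simp: free_mod_def fun_eq_iff)
  then show ?case using A.f0_is_0 B.f0_is_0 by simp
next
  case (Suc n)
  interpret K: field K by fact
  interpret F: module K "free_mod K S" by (rule free_mod_module) fact
  interpret A: mod_hom K "free_mod K S" P \<Phi>
    using assms free_mod_module by (simp add: mod_hom_def mod_hom_axioms_def)
  interpret B: mod_hom K "free_mod K S" P \<Psi>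
    using assms free_mod_module by (simp add: mod_hom_def mod_hom_axioms_def)
  from Suc have "{t\<in>S. f t \<noteq> \<zero>\<^bsub>K\<^esub>} \<noteq> {}" by (metis card.empty nat.simps(3))
  then obtain s where s: "s \<in> S" "f s \<noteq> \<zero>\<^bsub>K\<^esub>" by auto
  obtain f' where f': "f' \<in> carrier (free_mod K S)"
      "f = (f s \<odot>\<^bsub>free_mod K S\<^esub> free_gen K S s) \<oplus>\<^bsub>free_mod K S\<^esub> f'"
      "{t\<in>S. f' t \<noteq> \<zero>\<^bsub>K\<^esub>} = {t\<in>S. f t \<noteq> \<zero>\<^bsub>K\<^esub>} - {s}"
    using free_mod_decomp[OF assms(1) Suc.prems s] by blast
  have "n = card {t\<in>S. f' t \<noteq> \<zero>\<^bsub>K\<^esub>}" using Suc.hyps(2) s f'(3) by simp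
  then have IH: "\<Phi> f' = \<Psi> f'" using Suc.hyps(1) f'(1) by blast
  have g: "free_gen K S s \<in> carrier (free_mod K S)" by (rule free_gen_closed[OF assms(1) s(1)])
  have c: "f s \<in> carrier K" using Suc.prems s by (auto simp: free_mod_def)
  have "\<Phi> ((f s \<odot>\<^bsub>free_mod K S\<^esub> free_gen K S s) \<oplus>\<^bsub>free_mod K S\<^esub> f') =
        \<Psi> ((f s \<odot>\<^bsub>free_mod K S\<^esub> free_gen K S s) \<oplus>\<^bsub>free_mod K S\<^esub> f')"
    using g c f'(1) eq[OF s(1)] IH by simp
  then show ?case using f'(2) by simp
qed

lemma free_hom_exists:
  assumes "field K" "module K P" and \<beta>: "\<And>s. s \<in> S \<Longrightarrow> \<beta> s \<in> carrier P"
  shows "\<exists>\<Phi>\<in>module_hom K (free_mod K S) P. \<forall>s\<in>S. \<Phi> (free_gen K S s) = \<beta> s"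
proof -
  interpret K: field K by fact
  interpret P: module K P by fact
  interpret F: module K "free_mod K S" by (rule free_mod_module) fact
  define supp where "supp f = {t\<in>S. f t \<noteq> \<zero>\<^bsub>K\<^esub>}" for f
  define \<Phi> where "\<Phi> f = (\<Oplus>\<^bsub>P\<^esub>s\<in>supp f. f s \<odot>\<^bsub>P\<^esub> \<beta> s)" for f
  have mem: "f s \<in> carrier K" if "f \<in> carrier (free_mod K S)" "s \<in> S" for f s
    using that by (auto simp: free_mod_def)
  have fin: "finite (supp f)" if "f \<in> carrier (free_mod K S)" for f
    using that by (simp add: free_mod_def supp_def)
  have \<Phi>: "\<Phi> f = (\<Oplus>\<^bsub>P\<^esub>s\<in>T. f s \<odot>\<^bsub>P\<^esub> \<beta> s)"
    if "f \<in> carrier (free_mod K S)" "finite T" "supp f \<subseteq> T" "T \<subseteq> S" for f T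
    unfolding \<Phi>_def
  proof (rule P.add.finprod_mono_neutral_cong_left)
    show "f i \<odot>\<^bsub>P\<^esub> \<beta> i = \<zero>\<^bsub>P\<^esub>" if "i \<in> T - supp f" for i
      using that \<open>T \<subseteq> S\<close> \<beta> by (auto simp: supp_def subset_eq)
    show "(\<lambda>s. f s \<odot>\<^bsub>P\<^esub> \<beta> s) \<in> T \<rightarrow> carrier P" using that \<beta> mem by auto
  qed (use that in auto)
  have "\<Phi> \<in> module_hom K (free_mod K S) P"
    unfolding module_hom_def
  proof (safe, goal_cases)
    case (1 f)
    then show ?case unfolding \<Phi>_def
      by (intro P.add.finprod_closed) (auto simp: supp_def \<beta> mem)
  next
    case (2 f g)
    let ?T = "supp f \<union> supp g"
    have T: "finite ?T" "?T \<subseteq> S" using fin 2 by (auto simp: supp_def)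
    have "supp (f \<oplus>\<^bsub>free_mod K S\<^esub> g) \<subseteq> ?T" by (auto simp: supp_def free_mod_def)
    then have "\<Phi> (f \<oplus>\<^bsub>free_mod K S\<^esub> g) =
        (\<Oplus>\<^bsub>P\<^esub>s\<in>?T. (f \<oplus>\<^bsub>free_mod K S\<^esub> g) s \<odot>\<^bsub>P\<^esub> \<beta> s)"
      using T 2 by (intro \<Phi>) auto
    also have "\<dots> = (\<Oplus>\<^bsub>P\<^esub>s\<in>?T. (f s \<odot>\<^bsub>P\<^esub> \<beta> s) \<oplus>\<^bsub>P\<^esub> (g s \<odot>\<^bsub>P\<^esub> \<beta> s))"
    proof (rule P.add.finprod_cong')
      fix i assume "i \<in> ?T"
      then have "i \<in> S" using T by auto
      then show "(f \<oplus>\<^bsub>free_mod K S\<^esub> g) i \<odot>\<^bsub>P\<^esub> \<beta> i = (f i \<odot>\<^bsub>P\<^esub> \<beta> i) \<oplus>\<^bsub>P\<^esub> (g i \<odot>\<^bsub>P\<^esub> \<beta> i)"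
        using mem[OF 2(1)] mem[OF 2(2)] \<beta> by (simp add: free_mod_def P.smult_l_distr)
    qed (use T mem 2 \<beta> in auto)
    also have "\<dots> = \<Phi> f \<oplus>\<^bsub>P\<^esub> \<Phi> g"
      using T 2 \<beta> mem by (subst P.add.finprod_multf) (auto simp: subset_eq \<Phi>[of _ ?T])
    finally show ?case .
  next
    case (3 c f)
    have T: "finite (supp f)" "supp f \<subseteq> S" using fin 3 by (auto simp: supp_def)
    have "supp (c \<odot>\<^bsub>free_mod K S\<^esub> f) \<subseteq> supp f" using 3 by (auto simp: supp_def free_mod_def)
    then have "\<Phi> (c \<odot>\<^bsub>free_mod K S\<^esub> f) =
        (\<Oplus>\<^bsub>P\<^esub>s\<in>supp f. (c \<odot>\<^bsub>free_mod K S\<^esub> f) s \<odot>\<^bsub>P\<^esub> \<beta> s)"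
      using T 3 by (intro \<Phi>) auto
    also have "\<dots> = (\<Oplus>\<^bsub>P\<^esub>s\<in>supp f. c \<odot>\<^bsub>P\<^esub> (f s \<odot>\<^bsub>P\<^esub> \<beta> s))"
    proof (rule P.add.finprod_cong')
      fix i assume "i \<in> supp f"
      then have "i \<in> S" using T by auto
      then show "(c \<odot>\<^bsub>free_mod K S\<^esub> f) i \<odot>\<^bsub>P\<^esub> \<beta> i = c \<odot>\<^bsub>P\<^esub> (f i \<odot>\<^bsub>P\<^esub> \<beta> i)"
        using mem[OF 3(2)] 3(1) \<beta> by (simp add: free_mod_def P.smult_assoc1)
    qed (use T mem 3 \<beta> in auto)
    also have "\<dots> = c \<odot>\<^bsub>P\<^esub> \<Phi> f" unfolding \<Phi>_def
      using T 3 \<beta> mem by (subst P.finsum_smult) auto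
    finally show ?case .
  qed
  moreover have "\<Phi> (free_gen K S s) = \<beta> s" if "s \<in> S" for s
  proof -
    have "\<Phi> (free_gen K S s) = (\<Oplus>\<^bsub>P\<^esub>t\<in>{s}. free_gen K S s t \<odot>\<^bsub>P\<^esub> \<beta> t)"
      using that by (intro \<Phi> free_gen_closed assms) (auto simp: supp_def free_gen_def)
    also have "\<dots> = \<beta> s" using that \<beta> by (simp add: free_gen_def)
    finally show ?thesis .
  qed
  ultimately show ?thesis by blast
qed

locale tensor_product = field K + V: module K V + W: module K W
  for K (structure) and V and W
begin

abbreviation "S \<equiv> carrier V \<times> carrier W"
abbreviation "F \<equiv> free_mod K S"
abbreviation "g \<equiv> free_gen K S"
abbreviation "N \<equiv> tensor_kernel K V W"
abbreviation "T \<equiv> tensor K V W"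

lemma fld: "field K" ..

lemma modF: "module K F" by (rule free_mod_module[OF fld])

sublocale F: module K F by (rule modF)

lemma g_closed: "v \<in> carrier V \<Longrightarrow> w \<in> carrier W \<Longrightarrow> g (v, w) \<in> carrier F"
  by (rule free_gen_closed[OF fld]) simp

lemma rels: "bilinear_relations K V W \<subseteq> carrier F"
  unfolding bilinear_relations_def Let_def
  by (safe; simp add: g_closed)

lemma subN: "LinearCombinations.submodule K N F"
  unfolding tensor_kernel_def by (rule F.span_is_submodule[OF rels])

lemma relsN: "bilinear_relations K V W \<subseteq> N"
  unfolding tensor_kernel_def by (rule F.in_own_span[OF rels])

lemmas qm = quot_mod_props[OF modF subN, folded tensor_def]

sublocale T: module K T by (rule qm(1))

lemma tens_closed: "v \<in> carrier V \<Longrightarrow> w \<in> carrier W \<Longrightarrow> tens K V W v w \<in> carrier T"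
  unfolding tens_def qm(4) by (rule imageI, rule g_closed)

lemma coset_eq:
  assumes "a \<in> carrier F" "b \<in> carrier F" "a \<ominus>\<^bsub>F\<^esub> b \<in> N"
  shows "N +>\<^bsub>F\<^esub> a = N +>\<^bsub>F\<^esub> b"
proof -
  have "a = (a \<ominus>\<^bsub>F\<^esub> b) \<oplus>\<^bsub>F\<^esub> b" using assms by (simp add: a_minus_def F.a_assoc F.l_neg)
  then have "N +>\<^bsub>F\<^esub> a = (N +>\<^bsub>F\<^esub> (a \<ominus>\<^bsub>F\<^esub> b)) \<oplus>\<^bsub>T\<^esub> (N +>\<^bsub>F\<^esub> b)"
    using assms qm(3)[of "a \<ominus>\<^bsub>F\<^esub> b" b] by (metis F.minus_closed)
  also have "N +>\<^bsub>F\<^esub> (a \<ominus>\<^bsub>F\<^esub> b) = \<zero>\<^bsub>T\<^esub>"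
    using qm(5)[of "a \<ominus>\<^bsub>F\<^esub> b"] assms by (simp add: tensor_def quot_mod_def)
  also have "\<zero>\<^bsub>T\<^esub> \<oplus>\<^bsub>T\<^esub> (N +>\<^bsub>F\<^esub> b) = N +>\<^bsub>F\<^esub> b"
    by (rule T.l_zero) (use assms qm(4) in blast)
  finally show ?thesis .
qed

lemma tens_add_left:
  assumes "v \<in> carrier V" "v' \<in> carrier V" "w \<in> carrier W"
  shows "tens K V W (v \<oplus>\<^bsub>V\<^esub> v') w = tens K V W v w \<oplus>\<^bsub>T\<^esub> tens K V W v' w"
proof -
  have "g (v \<oplus>\<^bsub>V\<^esub> v', w) \<ominus>\<^bsub>F\<^esub> (g (v, w) \<oplus>\<^bsub>F\<^esub> g (v', w)) \<in> bilinear_relations K V W"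
    unfolding bilinear_relations_def Let_def using assms by blast
  then have *: "g (v \<oplus>\<^bsub>V\<^esub> v', w) \<ominus>\<^bsub>F\<^esub> (g (v, w) \<oplus>\<^bsub>F\<^esub> g (v', w)) \<in> N" using relsN by (rule subsetD[rotated])
  have "N +>\<^bsub>F\<^esub> g (v \<oplus>\<^bsub>V\<^esub> v', w) = N +>\<^bsub>F\<^esub> ((g (v, w) \<oplus>\<^bsub>F\<^esub> g (v', w)))"
    by (rule coset_eq[OF _ _ *]) (use assms in \<open>simp_all add: g_closed\<close>)
  then show ?thesis
    unfolding tens_def by (simp only: qm(3) g_closed assms)
qed

lemma tens_add_right:
  assumes "v \<in> carrier V" "w \<in> carrier W" "w' \<in> carrier W"
  shows "tens K V W v (w \<oplus>\<^bsub>W\<^esub> w') = tens K V W v w \<oplus>\<^bsub>T\<^esub> tens K V W v w'"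
proof -
  have "g (v, w \<oplus>\<^bsub>W\<^esub> w') \<ominus>\<^bsub>F\<^esub> (g (v, w) \<oplus>\<^bsub>F\<^esub> g (v, w')) \<in> bilinear_relations K V W"
    unfolding bilinear_relations_def Let_def using assms by blast
  then have *: "g (v, w \<oplus>\<^bsub>W\<^esub> w') \<ominus>\<^bsub>F\<^esub> (g (v, w) \<oplus>\<^bsub>F\<^esub> g (v, w')) \<in> N" using relsN by (rule subsetD[rotated])
  have "N +>\<^bsub>F\<^esub> g (v, w \<oplus>\<^bsub>W\<^esub> w') = N +>\<^bsub>F\<^esub> ((g (v, w) \<oplus>\<^bsub>F\<^esub> g (v, w')))"
    by (rule coset_eq[OF _ _ *]) (use assms in \<open>simp_all add: g_closed\<close>)
  then show ?thesis
    unfolding tens_def by (simp only: qm(3) g_closed assms)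
qed

lemma tens_smult_left:
  assumes "c \<in> carrier K" "v \<in> carrier V" "w \<in> carrier W"
  shows "tens K V W (c \<odot>\<^bsub>V\<^esub> v) w = c \<odot>\<^bsub>T\<^esub> tens K V W v w"
proof -
  have "g (c \<odot>\<^bsub>V\<^esub> v, w) \<ominus>\<^bsub>F\<^esub> c \<odot>\<^bsub>F\<^esub> g (v, w) \<in> bilinear_relations K V W"
    unfolding bilinear_relations_def Let_def using assms by blast
  then have *: "g (c \<odot>\<^bsub>V\<^esub> v, w) \<ominus>\<^bsub>F\<^esub> c \<odot>\<^bsub>F\<^esub> g (v, w) \<in> N" using relsN by (rule subsetD[rotated])
  have "N +>\<^bsub>F\<^esub> g (c \<odot>\<^bsub>V\<^esub> v, w) = N +>\<^bsub>F\<^esub> (c \<odot>\<^bsub>F\<^esub> g (v, w))"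
    by (rule coset_eq[OF _ _ *]) (use assms in \<open>simp_all add: g_closed\<close>)
  then show ?thesis
    unfolding tens_def by (simp only: qm(2) g_closed assms)
qed

lemma tens_smult_right:
  assumes "c \<in> carrier K" "v \<in> carrier V" "w \<in> carrier W"
  shows "tens K V W v (c \<odot>\<^bsub>W\<^esub> w) = c \<odot>\<^bsub>T\<^esub> tens K V W v w"
proof -
  have "g (v, c \<odot>\<^bsub>W\<^esub> w) \<ominus>\<^bsub>F\<^esub> c \<odot>\<^bsub>F\<^esub> g (v, w) \<in> bilinear_relations K V W"
    unfolding bilinear_relations_def Let_def using assms by blast
  then have *: "g (v, c \<odot>\<^bsub>W\<^esub> w) \<ominus>\<^bsub>F\<^esub> c \<odot>\<^bsub>F\<^esub> g (v, w) \<in> N" using relsN by (rule subsetD[rotated])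
  have "N +>\<^bsub>F\<^esub> g (v, c \<odot>\<^bsub>W\<^esub> w) = N +>\<^bsub>F\<^esub> (c \<odot>\<^bsub>F\<^esub> g (v, w))"
    by (rule coset_eq[OF _ _ *]) (use assms in \<open>simp_all add: g_closed\<close>)
  then show ?thesis
    unfolding tens_def by (simp only: qm(2) g_closed assms)
qed

lemma tens_hom_eq:
  assumes "module K U" "h \<in> module_hom K T U" "h' \<in> module_hom K T U"
    and "\<And>v w. v \<in> carrier V \<Longrightarrow> w \<in> carrier W \<Longrightarrow> h (tens K V W v w) = h' (tens K V W v w)"
    and "t \<in> carrier T"
  shows "h t = h' t"
proof -
  obtain f where f: "f \<in> carrier F" "t = N +>\<^bsub>F\<^esub> f"
    using assms(5)[unfolded qm(4)] by (rule imageE)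
  have pi: "(\<lambda>f. k (N +>\<^bsub>F\<^esub> f)) \<in> module_hom K F U" if "k \<in> module_hom K T U" for k
  proof -
    have 1: "N +>\<^bsub>F\<^esub> f \<in> carrier T" if "f \<in> carrier F" for f using that qm(4) by blast
    have 2: "k (N +>\<^bsub>F\<^esub> (f \<oplus>\<^bsub>F\<^esub> f')) = k (N +>\<^bsub>F\<^esub> f) \<oplus>\<^bsub>U\<^esub> k (N +>\<^bsub>F\<^esub> f')"
      if "f \<in> carrier F" "f' \<in> carrier F" for f f'
      unfolding qm(3)[OF that, symmetric]
      using \<open>k \<in> module_hom K T U\<close> 1 that unfolding module_hom_def by blast
    have 3: "k (N +>\<^bsub>F\<^esub> (c \<odot>\<^bsub>F\<^esub> f)) = c \<odot>\<^bsub>U\<^esub> k (N +>\<^bsub>F\<^esub> f)"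
      if "c \<in> carrier K" "f \<in> carrier F" for c f
      unfolding qm(2)[OF that, symmetric]
      using \<open>k \<in> module_hom K T U\<close> 1 that unfolding module_hom_def by blast
    have 4: "k t \<in> carrier U" if "t \<in> carrier T" for t
      using \<open>k \<in> module_hom K T U\<close> that unfolding module_hom_def by blast
    show ?thesis unfolding module_hom_def using 1 2 3 4 by simp
  qed
  show ?thesis unfolding f(2)
  proof (rule free_hom_unique[OF fld assms(1) pi[OF assms(2)] pi[OF assms(3)] _ f(1)])
    fix s assume "s \<in> S"
    then obtain v w where "s = (v, w)" "v \<in> carrier V" "w \<in> carrier W" by (rule SigmaE)
    then show "h (N +>\<^bsub>F\<^esub> g s) = h' (N +>\<^bsub>F\<^esub> g s)"
      using assms(4)[of v w, unfolded tens_def] by (simp only:)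
  qed
qed

theorem tensor_lift_universal:
  assumes U: "module K U"
    and \<beta>: "\<And>v w. v \<in> carrier V \<Longrightarrow> w \<in> carrier W \<Longrightarrow> \<beta> v w \<in> carrier U"
    and \<beta>1: "\<And>v v' w. v \<in> carrier V \<Longrightarrow> v' \<in> carrier V \<Longrightarrow> w \<in> carrier W \<Longrightarrow>
          \<beta> (v \<oplus>\<^bsub>V\<^esub> v') w = \<beta> v w \<oplus>\<^bsub>U\<^esub> \<beta> v' w"
    and \<beta>2: "\<And>v w w'. v \<in> carrier V \<Longrightarrow> w \<in> carrier W \<Longrightarrow> w' \<in> carrier W \<Longrightarrow>
          \<beta> v (w \<oplus>\<^bsub>W\<^esub> w') = \<beta> v w \<oplus>\<^bsub>U\<^esub> \<beta> v w'"
    and \<beta>3: "\<And>c v w. c \<in> carrier K \<Longrightarrow> v \<in> carrier V \<Longrightarrow> w \<in> carrier W \<Longrightarrow>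
          \<beta> (c \<odot>\<^bsub>V\<^esub> v) w = c \<odot>\<^bsub>U\<^esub> \<beta> v w"
    and \<beta>4: "\<And>c v w. c \<in> carrier K \<Longrightarrow> v \<in> carrier V \<Longrightarrow> w \<in> carrier W \<Longrightarrow>
          \<beta> v (c \<odot>\<^bsub>W\<^esub> w) = c \<odot>\<^bsub>U\<^esub> \<beta> v w"
  shows "tensor_lift K V W U \<beta> \<in> module_hom K T U \<inter> extensional (carrier T)"
    and "v \<in> carrier V \<Longrightarrow> w \<in> carrier W \<Longrightarrow>
          tensor_lift K V W U \<beta> (tens K V W v w) = \<beta> v w"
proof -
  interpret U: module K U by (rule U)
  obtain \<Phi> where \<Phi>: "\<Phi> \<in> module_hom K F U"
      "\<And>v w. v \<in> carrier V \<Longrightarrow> w \<in> carrier W \<Longrightarrow> \<Phi> (g (v, w)) = \<beta> v w"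
  proof -
    have "\<exists>\<Phi>\<in>module_hom K F U. \<forall>s\<in>S. \<Phi> (g s) = (\<lambda>(v, w). \<beta> v w) s"
      by (rule free_hom_exists[OF fld U]) (use \<beta> in auto)
    then show ?thesis using that by fastforce
  qed
  interpret \<Phi>: mod_hom K F U \<Phi>
    using \<Phi>(1) U modF by (simp add: mod_hom_def mod_hom_axioms_def)
  have "bilinear_relations K V W \<subseteq> \<Phi>.ker"
    unfolding bilinear_relations_def Let_def \<Phi>.ker_def
    by (auto simp: g_closed \<Phi>(2) \<beta> \<beta>1 \<beta>2 \<beta>3 \<beta>4 a_minus_def U.r_neg F.smult_closed)
  then have "N \<subseteq> \<Phi>.ker"
    unfolding tensor_kernel_def using F.span_is_subset \<Phi>.ker_is_submodule by blast
  then have ker: "\<Phi> n = \<zero>\<^bsub>U\<^esub>" if "n \<in> N" for n using that by (auto simp: \<Phi>.ker_def)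
  define h where "h = (\<lambda>C\<in>carrier T. \<Phi> (SOME f. f \<in> C))"
  have h: "h (N +>\<^bsub>F\<^esub> f) = \<Phi> f" if f: "f \<in> carrier F" for f
  proof -
    interpret ab: abelian_subgroup N F by (rule submodule_abelian_subgroup[OF modF subN])
    have "f \<in> N +>\<^bsub>F\<^esub> f" by (rule ab.a_rcos_self[OF f])
    then have "(SOME f'. f' \<in> N +>\<^bsub>F\<^esub> f) \<in> N +>\<^bsub>F\<^esub> f"
      by (rule someI[where P = "\<lambda>f'. f' \<in> N +>\<^bsub>F\<^esub> f"])
    then obtain n where n: "n \<in> N" "(SOME f'. f' \<in> N +>\<^bsub>F\<^esub> f) = n \<oplus>\<^bsub>F\<^esub> f"
      by (auto simp: a_r_coset_def r_coset_def)
    then have "n \<in> carrier F" using ab.a_subset by auto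
    moreover have "N +>\<^bsub>F\<^esub> f \<in> carrier T" using f qm(4) by blast
    ultimately show ?thesis using f n ker[OF n(1)] by (simp add: h_def)
  qed
  have h1: "h \<in> module_hom K T U \<inter> extensional (carrier T)"
  proof
    have carr: "\<exists>f\<in>carrier F. t = N +>\<^bsub>F\<^esub> f" if "t \<in> carrier T" for t
      using that qm(4) by blast
    show "h \<in> module_hom K T U"
      unfolding module_hom_def
    proof (safe, goal_cases)
      case (1 t)
      from carr[OF this] show ?case using h by auto
    next
      case (2 t t')
      from carr[OF 2(1)] carr[OF 2(2)] show ?case using h by (auto simp: qm(3))
    next
      case (3 c t)
      from carr[OF 3(2)] 3(1) show ?case using h by (auto simp: qm(2))
    qed
    show "h \<in> extensional (carrier T)" by (simp add: h_def)
  qed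
  have h2: "\<forall>v\<in>carrier V. \<forall>w\<in>carrier W. h (tens K V W v w) = \<beta> v w"
  proof (intro ballI)
    fix v w assume vw: "v \<in> carrier V" "w \<in> carrier W"
    show "h (tens K V W v w) = \<beta> v w"
      unfolding tens_def by (rule trans[OF h[OF g_closed[OF vw]] \<Phi>(2)[OF vw]])
  qed
  have "h' = h" if "h' \<in> module_hom K T U \<inter> extensional (carrier T)"
    "\<forall>v\<in>carrier V. \<forall>w\<in>carrier W. h' (tens K V W v w) = \<beta> v w" for h'
  proof (rule extensionalityI)
    fix t assume t: "t \<in> carrier T"
    show "h' t = h t"
      by (rule tens_hom_eq[OF U _ _ _ t]) (use that h1 h2 in auto)
  qed (use that h1 in auto)
  then have "tensor_lift K V W U \<beta> = h"
    unfolding tensor_lift_def using h1 h2 by (intro the_equality) blast+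
  then show "tensor_lift K V W U \<beta> \<in> module_hom K T U \<inter> extensional (carrier T)"
    and "v \<in> carrier V \<Longrightarrow> w \<in> carrier W \<Longrightarrow>
          tensor_lift K V W U \<beta> (tens K V W v w) = \<beta> v w"
    using h1 h2 by auto
qed

end

subsection \<open>Maps between tensor products\<close>

definition tensor_map ::
  "('k, 'm) ring_scheme \<Rightarrow> ('k, 'v, 'n) module_scheme \<Rightarrow> ('k, 'w, 'p) module_scheme
    \<Rightarrow> ('k, 'v2, 'n2) module_scheme \<Rightarrow> ('k, 'w2, 'p2) module_scheme
    \<Rightarrow> ('v \<Rightarrow> 'v2) \<Rightarrow> ('w \<Rightarrow> 'w2) \<Rightarrow> ('v \<times> 'w \<Rightarrow> 'k) set \<Rightarrow> ('v2 \<times> 'w2 \<Rightarrow> 'k) set" where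
  "tensor_map K V W V' W' f g =
     tensor_lift K V W (tensor K V' W') (\<lambda>v w. tens K V' W' (f v) (g w))"

definition tensor_flip ::
  "('k, 'm) ring_scheme \<Rightarrow> ('k, 'v, 'n) module_scheme
    \<Rightarrow> ('v \<times> 'v \<Rightarrow> 'k) set \<Rightarrow> ('v \<times> 'v \<Rightarrow> 'k) set" where
  "tensor_flip K V = tensor_lift K V V (tensor K V V) (\<lambda>v w. tens K V V w v)"

text \<open>The associativity isomorphism \<open>(V \<otimes> V) \<otimes> V \<rightarrow> V \<otimes> (V \<otimes> V)\<close> and its inverse.\<close>

definition tensor_assoc ::
  "('k, 'm) ring_scheme \<Rightarrow> ('k, 'v, 'n) module_scheme
    \<Rightarrow> (('v \<times> 'v \<Rightarrow> 'k) set \<times> 'v \<Rightarrow> 'k) set \<Rightarrow> ('v \<times> ('v \<times> 'v \<Rightarrow> 'k) set \<Rightarrow> 'k) set" where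
  "tensor_assoc K V =
     (let VV = tensor K V V; V_VV = tensor K V VV in
        tensor_lift K VV V V_VV
          (\<lambda>t w. tensor_lift K V V V_VV (\<lambda>u v. tens K V VV u (tens K V V v w)) t))"

definition tensor_assoc_inv ::
  "('k, 'm) ring_scheme \<Rightarrow> ('k, 'v, 'n) module_scheme
    \<Rightarrow> ('v \<times> ('v \<times> 'v \<Rightarrow> 'k) set \<Rightarrow> 'k) set \<Rightarrow> (('v \<times> 'v \<Rightarrow> 'k) set \<times> 'v \<Rightarrow> 'k) set" where
  "tensor_assoc_inv K V =
     (let VV = tensor K V V; VV_V = tensor K VV V in
        tensor_lift K V VV VV_V
          (\<lambda>u t. tensor_lift K V V VV_V (\<lambda>v w. tens K VV V (tens K V V u v) w) t))"

section \<open>Yang--Baxter operators\<close>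

text \<open>\<open>End\<^sub>K(V)\<close> as a monoid under composition.\<close>

definition lin_endo ::
  "('k, 'm) ring_scheme \<Rightarrow> ('k, 'v, 'n) module_scheme \<Rightarrow> ('v \<Rightarrow> 'v) monoid" where
  "lin_endo K V =
     \<lparr>carrier = module_hom K V V \<inter> extensional (carrier V),
      monoid.mult = compose (carrier V), one = (\<lambda>v\<in>carrier V. v)\<rparr>"

text \<open>
  \<open>V \<otimes> V \<otimes> V\<close> is realised as \<open>(V \<otimes> V) \<otimes> V\<close>.  The operators on factors 2,3 and 1,3 are transported
  to it by the associativity isomorphism and by the flip \<open>\<tau>\<close> of the last two factors:
  \<open>T\<^sub>1\<^sub>3 = \<tau>\<^sub>2\<^sub>3 T\<^sub>1\<^sub>2 \<tau>\<^sub>2\<^sub>3\<close>.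
\<close>

definition tensor3 ::
  "('k, 'm) ring_scheme \<Rightarrow> ('k, 'v, 'n) module_scheme
    \<Rightarrow> ('k, (('v \<times> 'v \<Rightarrow> 'k) set \<times> 'v \<Rightarrow> 'k) set) module" where
  "tensor3 K V = tensor K (tensor K V V) V"

definition op12 where
  "op12 K V T = tensor_map K (tensor K V V) V (tensor K V V) V T (\<lambda>v. v)"

definition op23 where
  "op23 K V T =
     compose (carrier (tensor3 K V)) (tensor_assoc_inv K V)
       (compose (carrier (tensor3 K V))
         (tensor_map K V (tensor K V V) V (tensor K V V) (\<lambda>v. v) T) (tensor_assoc K V))"

definition op13 where
  "op13 K V T =
     (let \<tau>\<^sub>2\<^sub>3 = op23 K V (tensor_flip K V) in
        \<tau>\<^sub>2\<^sub>3 \<otimes>\<^bsub>lin_endo K (tensor3 K V)\<^esub> op12 K V T \<otimes>\<^bsub>lin_endo K (tensor3 K V)\<^esub> \<tau>\<^sub>2\<^sub>3)"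

definition one_param_yang_baxter ::
  "('k, 'm) ring_scheme \<Rightarrow> 'x set \<Rightarrow> ('x \<times> 'x) set \<Rightarrow> ('x \<times> 'x \<Rightarrow> 'x)
    \<Rightarrow> ('k, 'v, 'n) module_scheme
    \<Rightarrow> ('x \<Rightarrow> ('v \<times> 'v \<Rightarrow> 'k) set \<Rightarrow> ('v \<times> 'v \<Rightarrow> 'k) set) \<Rightarrow> bool" where
  "one_param_yang_baxter K X Z \<phi> V R \<longleftrightarrow>
     vectorspace K V \<and> vectorspace.fin_dim K V \<and>
     Z \<subseteq> X \<times> X \<and> \<phi> \<in> Z \<rightarrow> X \<and> R \<in> X \<rightarrow> carrier (lin_endo K (tensor K V V)) \<and>
     (\<forall>(x, z)\<in>Z.
        op12 K V (R x) \<otimes>\<^bsub>lin_endo K (tensor3 K V)\<^esub> op13 K V (R (\<phi> (x, z)))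
          \<otimes>\<^bsub>lin_endo K (tensor3 K V)\<^esub> op23 K V (R z) =
        op23 K V (R z) \<otimes>\<^bsub>lin_endo K (tensor3 K V)\<^esub> op13 K V (R (\<phi> (x, z)))
          \<otimes>\<^bsub>lin_endo K (tensor3 K V)\<^esub> op12 K V (R x))"

section \<open>Associative unital algebras\<close>

text \<open>The locale \<^locale>\<open>algebra\<close> of \<open>HOL-Algebra\<close> requires commutativity.\<close>

locale assoc_algebra = vectorspace K A + ring A for K (structure) and A (structure) +
  assumes smult_mult_left:
      "\<lbrakk>c \<in> carrier K; a \<in> carrier A; b \<in> carrier A\<rbrakk>
        \<Longrightarrow> (c \<odot>\<^bsub>A\<^esub> a) \<otimes>\<^bsub>A\<^esub> b = c \<odot>\<^bsub>A\<^esub> (a \<otimes>\<^bsub>A\<^esub> b)"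
    and smult_mult_right:
      "\<lbrakk>c \<in> carrier K; a \<in> carrier A; b \<in> carrier A\<rbrakk>
        \<Longrightarrow> a \<otimes>\<^bsub>A\<^esub> (c \<odot>\<^bsub>A\<^esub> b) = c \<odot>\<^bsub>A\<^esub> (a \<otimes>\<^bsub>A\<^esub> b)"

end

theory Submission
  imports Defs
begin

text \<open>
  Both sides of the Yang--Baxter equation are linear, so they are compared on elementary tensors
  \<open>a \<otimes> b \<otimes> c\<close>, where \<open>R'\<^sub>1\<^sub>2\<close>, \<open>R'\<^sub>1\<^sub>3\<close> and \<open>R'\<^sub>2\<^sub>3\<close> produce only tensors whose entries are
  \<open>1\<close>, \<open>a\<close>, \<open>b\<close>, \<open>c\<close>, \<open>ab\<close>, \<open>ac\<close>, \<open>bc\<close> and \<open>abc\<close>.  The equation becomes an identity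
  between linear combinations of such tensors that uses only associativity and the unit.
  Likewise the two composites of \<open>R'(x)\<close> with the claimed inverse fix every \<open>a \<otimes> b\<close>.
\<close>

section \<open>Differences in abelian groups and linear maps\<close>

context abelian_group
begin

lemma a_add_diff:
  "\<lbrakk>a \<in> carrier G; b \<in> carrier G; c \<in> carrier G\<rbrakk> \<Longrightarrow> a \<oplus> (b \<ominus> c) = (a \<oplus> b) \<ominus> c"
  by (simp add: minus_eq a_ac)

lemma a_diff_add:
  "\<lbrakk>a \<in> carrier G; b \<in> carrier G; c \<in> carrier G\<rbrakk> \<Longrightarrow> (a \<ominus> b) \<oplus> c = (a \<oplus> c) \<ominus> b"
  by (simp add: minus_eq a_ac)

lemma a_diff_diff:
  "\<lbrakk>a \<in> carrier G; b \<in> carrier G; c \<in> carrier G\<rbrakk> \<Longrightarrow> (a \<ominus> b) \<ominus> c = a \<ominus> (b \<oplus> c)"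
  by (simp add: minus_eq minus_add a_ac)

lemma a_diff_diff_right:
  "\<lbrakk>a \<in> carrier G; b \<in> carrier G; c \<in> carrier G\<rbrakk> \<Longrightarrow> a \<ominus> (b \<ominus> c) = (a \<oplus> c) \<ominus> b"
  by (simp add: minus_eq minus_add a_ac)

lemma a_diff_eq_iff:
  "\<lbrakk>a \<in> carrier G; b \<in> carrier G; c \<in> carrier G\<rbrakk> \<Longrightarrow> a \<ominus> b = c \<longleftrightarrow> a = c \<oplus> b"
  by (metis add.inv_solve_right' minus_eq)

lemma a_eq_diff_iff:
  "\<lbrakk>a \<in> carrier G; b \<in> carrier G; c \<in> carrier G\<rbrakk> \<Longrightarrow> a = c \<ominus> b \<longleftrightarrow> a \<oplus> b = c"
  using a_diff_eq_iff[of c b a] by auto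

text \<open>As rewrite rules, the first four gather a sum of differences into a single difference,
  and the last two carry the subtracted part across an equation. Together they turn an identity with
  signs into one between plain sums, which commutativity can then sort.\<close>

lemmas a_diff_simps =
  a_add_diff a_diff_add a_diff_diff a_diff_diff_right a_diff_eq_iff a_eq_diff_iff

end

lemma (in module) smult_minus_right:
  "\<lbrakk>c \<in> carrier R; u \<in> carrier M; v \<in> carrier M\<rbrakk>
    \<Longrightarrow> c \<odot>\<^bsub>M\<^esub> (u \<ominus>\<^bsub>M\<^esub> v) = c \<odot>\<^bsub>M\<^esub> u \<ominus>\<^bsub>M\<^esub> c \<odot>\<^bsub>M\<^esub> v"
  by (simp add: M.minus_eq smult_r_distr smult_r_minus)

text \<open>This is commutativity of the scalar ring, in the form that lets ordered rewriting sort
  iterated scalars such as \<open>x\<close> and \<open>z\<close>.\<close>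

lemma (in module) smult_left_commute:
  "\<lbrakk>c \<in> carrier R; d \<in> carrier R; u \<in> carrier M\<rbrakk>
    \<Longrightarrow> c \<odot>\<^bsub>M\<^esub> (d \<odot>\<^bsub>M\<^esub> u) = d \<odot>\<^bsub>M\<^esub> (c \<odot>\<^bsub>M\<^esub> u)"
  by (simp add: smult_assoc1[symmetric] R.m_comm)

lemma module_hom_diff:
  assumes "module K M" "module K N" "f \<in> module_hom K M N" "u \<in> carrier M" "v \<in> carrier M"
  shows "f (u \<ominus>\<^bsub>M\<^esub> v) = f u \<ominus>\<^bsub>N\<^esub> f v"
proof -
  interpret M: module K M by fact
  interpret N: module K N by fact
  have cl: "f w \<in> carrier N" if "w \<in> carrier M" for w
    using module_hom_closed[OF assms(3)] that by auto
  have "f (u \<ominus>\<^bsub>M\<^esub> v) \<oplus>\<^bsub>N\<^esub> f v = f u"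
    using module_hom_add[OF assms(3), of "u \<ominus>\<^bsub>M\<^esub> v" v] assms(4,5)
    by (simp add: M.minus_eq M.a_assoc M.l_neg)
  then show ?thesis using assms(4,5) cl by (simp add: N.a_eq_diff_iff)
qed

text \<open>The combination has exactly the shape of \<open>R'(x)(a \<otimes> b)\<close>, so a
  linear map passes through a value of \<open>R'\<close> in one rewrite.\<close>

lemma module_hom_lincomb:
  assumes "module K M" "module K N" "f \<in> module_hom K M N"
    and "c \<in> carrier K" "u \<in> carrier M" "v \<in> carrier M" "w \<in> carrier M"
  shows "f (c \<odot>\<^bsub>M\<^esub> u \<oplus>\<^bsub>M\<^esub> v \<ominus>\<^bsub>M\<^esub> w) = c \<odot>\<^bsub>N\<^esub> f u \<oplus>\<^bsub>N\<^esub> f v \<ominus>\<^bsub>N\<^esub> f w"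
proof -
  interpret M: module K M by fact
  show ?thesis
    using assms(4-)
    by (simp add: module_hom_diff[OF assms(1-3)] module_hom_add[OF assms(3)]
        module_hom_smult[OF assms(3)])
qed

lemma module_hom_id: "(\<lambda>v. v) \<in> module_hom K V V"
  by (simp add: module_hom_def)

lemma module_hom_compose:
  assumes "module K M" "f \<in> module_hom K L M" "g \<in> module_hom K M N" "module K L"
  shows "compose (carrier L) g f \<in> module_hom K L N"
proof -
  interpret L: module K L by fact
  show ?thesis
    using assms(2,3) by (auto simp: module_hom_def compose_def Pi_def)
qed

section \<open>The monoid of linear endomorphisms\<close>

lemma lin_endo_carrier:
  "f \<in> carrier (lin_endo K M) \<longleftrightarrow> f \<in> module_hom K M M \<and> f \<in> extensional (carrier M)"
  by (simp add: lin_endo_def)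

lemma lin_endo_mult: "f \<otimes>\<^bsub>lin_endo K M\<^esub> g = compose (carrier M) f g"
  by (simp add: lin_endo_def)

text \<open>The unit laws rest on extensionality: composing with the restricted identity gives back
  a function only if it is \<open>undefined\<close> outside the module.\<close>

lemma lin_endo_monoid:
  assumes "module K M" shows "monoid (lin_endo K M)"
proof
  interpret M: module K M by fact
  note cl = module_hom_closed
  fix f g h
  assume f: "f \<in> carrier (lin_endo K M)"
  have fC: "f \<in> carrier M \<rightarrow> carrier M" using f by (auto simp: lin_endo_carrier dest: cl)
  show "\<one>\<^bsub>lin_endo K M\<^esub> \<otimes>\<^bsub>lin_endo K M\<^esub> f = f" "f \<otimes>\<^bsub>lin_endo K M\<^esub> \<one>\<^bsub>lin_endo K M\<^esub> = f"
    using f fC by (auto simp: lin_endo_def intro: Id_compose compose_Id)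
  assume g: "g \<in> carrier (lin_endo K M)"
  show "f \<otimes>\<^bsub>lin_endo K M\<^esub> g \<in> carrier (lin_endo K M)"
    using f g by (simp add: lin_endo_carrier lin_endo_mult module_hom_compose[OF assms _ _ assms])
  assume h: "h \<in> carrier (lin_endo K M)"
  show "f \<otimes>\<^bsub>lin_endo K M\<^esub> g \<otimes>\<^bsub>lin_endo K M\<^esub> h = f \<otimes>\<^bsub>lin_endo K M\<^esub> (g \<otimes>\<^bsub>lin_endo K M\<^esub> h)"
    using h by (auto simp: lin_endo_mult lin_endo_carrier intro!: compose_assoc[symmetric] dest: cl)
next
  interpret M: module K M by fact
  show "\<one>\<^bsub>lin_endo K M\<^esub> \<in> carrier (lin_endo K M)"
    by (auto simp: lin_endo_def module_hom_def)
qed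

section \<open>Bilinear maps\<close>

text \<open>Bilinearity is expressed as linearity in each argument, so that its closure properties
  are inherited from \<open>module_hom\<close>.\<close>

definition bilinear_map ::
  "('k, 'm) ring_scheme \<Rightarrow> ('k, 'v, 'n) module_scheme \<Rightarrow> ('k, 'w, 'p) module_scheme
    \<Rightarrow> ('k, 'u, 'q) module_scheme \<Rightarrow> ('v \<Rightarrow> 'w \<Rightarrow> 'u) \<Rightarrow> bool" where
  "bilinear_map K V W U \<beta> \<longleftrightarrow>
     (\<forall>v\<in>carrier V. \<beta> v \<in> module_hom K W U) \<and>
     (\<forall>w\<in>carrier W. (\<lambda>v. \<beta> v w) \<in> module_hom K V U)"

lemma bilinear_mapI:
  assumes "\<And>v. v \<in> carrier V \<Longrightarrow> \<beta> v \<in> module_hom K W U"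
    and "\<And>w. w \<in> carrier W \<Longrightarrow> (\<lambda>v. \<beta> v w) \<in> module_hom K V U"
  shows "bilinear_map K V W U \<beta>"
  using assms by (simp add: bilinear_map_def)

lemma bilinear_map_right: "bilinear_map K V W U \<beta> \<Longrightarrow> v \<in> carrier V \<Longrightarrow> \<beta> v \<in> module_hom K W U"
  and bilinear_map_left:
    "bilinear_map K V W U \<beta> \<Longrightarrow> w \<in> carrier W \<Longrightarrow> (\<lambda>v. \<beta> v w) \<in> module_hom K V U"
  by (simp_all add: bilinear_map_def)

lemma bilinear_map_swap: "bilinear_map K V W U \<beta> \<Longrightarrow> bilinear_map K W V U (\<lambda>w v. \<beta> v w)"
  by (simp add: bilinear_map_def)

lemma module_hom_comp:
  "f \<in> module_hom K L M \<Longrightarrow> g \<in> module_hom K M N \<Longrightarrow> (\<lambda>t. g (f t)) \<in> module_hom K L N"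
  by (auto simp: module_hom_def Pi_def)

lemma bilinear_map_hom:
  "bilinear_map K V W U \<beta> \<Longrightarrow> f \<in> module_hom K U U' \<Longrightarrow> bilinear_map K V W U' (\<lambda>v w. f (\<beta> v w))"
  by (auto simp: bilinear_map_def intro: module_hom_comp)

lemma bilinear_map_comp:
  assumes "bilinear_map K V' W' U \<beta>" "f \<in> module_hom K V V'" "g \<in> module_hom K W W'"
  shows "bilinear_map K V W U (\<lambda>v w. \<beta> (f v) (g w))"
proof (rule bilinear_mapI)
  fix v assume "v \<in> carrier V"
  then have "f v \<in> carrier V'" using module_hom_closed[OF assms(2)] by auto
  then show "(\<lambda>w. \<beta> (f v) (g w)) \<in> module_hom K W U"
    by (intro module_hom_comp[OF assms(3)] bilinear_map_right[OF assms(1)])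
next
  fix w assume "w \<in> carrier W"
  then have "g w \<in> carrier W'" using module_hom_closed[OF assms(3)] by auto
  then show "(\<lambda>v. \<beta> (f v) (g w)) \<in> module_hom K V U"
    using module_hom_comp[OF assms(2) bilinear_map_left[OF assms(1)]] by simp
qed

section \<open>Linear combinations of linear and of bilinear maps\<close>

lemma module_hom_plus:
  assumes "module K M" "f \<in> module_hom K L M" "g \<in> module_hom K L M"
  shows "(\<lambda>t. f t \<oplus>\<^bsub>M\<^esub> g t) \<in> module_hom K L M"
proof -
  interpret M: module K M by fact
  show ?thesis
    using assms(2,3) by (auto simp: module_hom_def M.a_ac M.smult_r_distr Pi_def)
qed

lemma module_hom_scale:
  assumes "module K M" "c \<in> carrier K" "f \<in> module_hom K L M"
  shows "(\<lambda>t. c \<odot>\<^bsub>M\<^esub> f t) \<in> module_hom K L M"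
proof -
  interpret M: module K M by fact
  show ?thesis
    using assms(2,3)
    by (auto simp: module_hom_def M.smult_r_distr M.smult_assoc1[symmetric] M.m_comm Pi_def)
qed

lemma module_hom_minus:
  assumes "module K M" "f \<in> module_hom K L M" "g \<in> module_hom K L M"
  shows "(\<lambda>t. f t \<ominus>\<^bsub>M\<^esub> g t) \<in> module_hom K L M"
proof -
  interpret M: module K M by fact
  show ?thesis
    using assms(2,3)
    by (auto simp: module_hom_def M.a_ac M.smult_minus_right M.smult_r_distr M.a_diff_simps Pi_def)
qed

lemma bilinear_map_plus:
  assumes "module K U" "bilinear_map K V W U \<beta>" "bilinear_map K V W U \<gamma>"
  shows "bilinear_map K V W U (\<lambda>v w. \<beta> v w \<oplus>\<^bsub>U\<^esub> \<gamma> v w)"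
  using assms by (auto simp: bilinear_map_def intro: module_hom_plus)

lemma bilinear_map_minus:
  assumes "module K U" "bilinear_map K V W U \<beta>" "bilinear_map K V W U \<gamma>"
  shows "bilinear_map K V W U (\<lambda>v w. \<beta> v w \<ominus>\<^bsub>U\<^esub> \<gamma> v w)"
  using assms by (auto simp: bilinear_map_def intro: module_hom_minus)

lemma bilinear_map_scale:
  assumes "module K U" "c \<in> carrier K" "bilinear_map K V W U \<beta>"
  shows "bilinear_map K V W U (\<lambda>v w. c \<odot>\<^bsub>U\<^esub> \<beta> v w)"
  using assms by (auto simp: bilinear_map_def intro: module_hom_scale)

section \<open>The universal property in terms of bilinear maps\<close>

context tensor_product
begin

lemma bilinear_map_tens: "bilinear_map K V W T (tens K V W)"
  by (rule bilinear_mapI)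
     (auto simp: module_hom_def tens_closed tens_add_left tens_add_right
       tens_smult_left tens_smult_right)

lemma tensor_lift:
  assumes "module K U" "bilinear_map K V W U \<beta>"
  shows tensor_lift_hom: "tensor_lift K V W U \<beta> \<in> module_hom K T U"
    and tensor_lift_ext: "tensor_lift K V W U \<beta> \<in> extensional (carrier T)"
    and tensor_lift_tens: "v \<in> carrier V \<Longrightarrow> w \<in> carrier W \<Longrightarrow>
          tensor_lift K V W U \<beta> (tens K V W v w) = \<beta> v w"
proof -
  have r: "\<beta> v \<in> module_hom K W U" if "v \<in> carrier V" for v
    by (rule bilinear_map_right[OF assms(2) that])
  have l: "(\<lambda>v. \<beta> v w) \<in> module_hom K V U" if "w \<in> carrier W" for w
    by (rule bilinear_map_left[OF assms(2) that])
  \<comment> \<open>These are the five premises on \<open>\<beta>\<close> of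
    \<open>tensor_lift_universal\<close>, in its order: closure, additivity on the left and right,
    homogeneity on the left and right.\<close>
  note facts = funcset_mem[OF module_hom_closed[OF r]]
    module_hom_add[OF l] module_hom_add[OF r] module_hom_smult[OF l] module_hom_smult[OF r]
  show "tensor_lift K V W U \<beta> \<in> module_hom K T U"
    and "tensor_lift K V W U \<beta> \<in> extensional (carrier T)"
    using tensor_lift_universal(1)[OF assms(1) facts] by simp_all
  show "v \<in> carrier V \<Longrightarrow> w \<in> carrier W \<Longrightarrow>
          tensor_lift K V W U \<beta> (tens K V W v w) = \<beta> v w"
    by (rule tensor_lift_universal(2)[OF assms(1) facts])
qed

text \<open>Made for lifts nested in lifts, as in the associativity maps: a family of bilinear maps
  depending linearly on a parameter induces linear maps that again depend linearly on it. For fixed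
  parameters both sides of each law are linear in \<open>t\<close>, so they need only agree on
  elementary tensors.\<close>

lemma bilinear_map_tensor_lift:
  assumes U: "module K U" and X: "module K X"
    and \<beta>: "\<And>x. x \<in> carrier X \<Longrightarrow> bilinear_map K V W U (\<beta> x)"
    and \<beta>X: "\<And>v w. v \<in> carrier V \<Longrightarrow> w \<in> carrier W \<Longrightarrow> (\<lambda>x. \<beta> x v w) \<in> module_hom K X U"
  shows "bilinear_map K X T U (\<lambda>x. tensor_lift K V W U (\<beta> x))"
proof (rule bilinear_mapI)
  interpret X: module K X by fact
  note hom = tensor_lift_hom[OF U \<beta>] and val = tensor_lift_tens[OF U \<beta>]
  show "tensor_lift K V W U (\<beta> x) \<in> module_hom K T U" if "x \<in> carrier X" for x
    by (rule hom[OF that])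
  fix t assume t: "t \<in> carrier T"
  show "(\<lambda>x. tensor_lift K V W U (\<beta> x) t) \<in> module_hom K X U"
    unfolding module_hom_def
  proof (safe, goal_cases)
    case (1 x)
    then show ?case using module_hom_closed[OF hom] t by blast
  next
    case (2 x y)
    show ?case
      by (rule tens_hom_eq[OF U hom module_hom_plus[OF U hom hom] _ t])
         (use 2 in \<open>simp_all add: val module_hom_add[OF \<beta>X]\<close>)
  next
    case (3 c x)
    show ?case
      by (rule tens_hom_eq[OF U hom module_hom_scale[OF U _ hom] _ t])
         (use 3 in \<open>simp_all add: val module_hom_smult[OF \<beta>X]\<close>)
  qed
qed

end

lemma tensor_map:
  assumes "tensor_product K V W" "tensor_product K V' W'"
    and f: "f \<in> module_hom K V V'" and g: "g \<in> module_hom K W W'"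
  shows tensor_map_hom: "tensor_map K V W V' W' f g \<in> module_hom K (tensor K V W) (tensor K V' W')"
    and tensor_map_ext: "tensor_map K V W V' W' f g \<in> extensional (carrier (tensor K V W))"
    and tensor_map_tens: "v \<in> carrier V \<Longrightarrow> w \<in> carrier W \<Longrightarrow>
          tensor_map K V W V' W' f g (tens K V W v w) = tens K V' W' (f v) (g w)"
proof -
  interpret D: tensor_product K V W by fact
  interpret C: tensor_product K V' W' by fact
  note * = C.T.module_axioms bilinear_map_comp[OF C.bilinear_map_tens f g]
  show "tensor_map K V W V' W' f g \<in> module_hom K (tensor K V W) (tensor K V' W')"
    "tensor_map K V W V' W' f g \<in> extensional (carrier (tensor K V W))"
    "v \<in> carrier V \<Longrightarrow> w \<in> carrier W \<Longrightarrow>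
       tensor_map K V W V' W' f g (tens K V W v w) = tens K V' W' (f v) (g w)"
    unfolding tensor_map_def
    by (fact D.tensor_lift_hom[OF *] D.tensor_lift_ext[OF *] D.tensor_lift_tens[OF *])+
qed

text \<open>Existence is the induced map; uniqueness holds because linear maps are determined on
  elementary tensors and extensionality fixes the values elsewhere. It yields both
  \<open>R'(x)\<close> and the candidate for its inverse.\<close>

lemma (in tensor_product) lin_endo_tens_ex1:
  assumes "bilinear_map K V W T \<beta>"
  shows "\<exists>!h. h \<in> carrier (lin_endo K T) \<and>
    (\<forall>v\<in>carrier V. \<forall>w\<in>carrier W. h (tens K V W v w) = \<beta> v w)"
proof (rule ex_ex1I)
  note * = T.module_axioms assms
  show "\<exists>h. h \<in> carrier (lin_endo K T) \<and>
    (\<forall>v\<in>carrier V. \<forall>w\<in>carrier W. h (tens K V W v w) = \<beta> v w)"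
    unfolding lin_endo_carrier
    using tensor_lift_hom[OF *] tensor_lift_ext[OF *] tensor_lift_tens[OF *] by blast
next
  fix h h'
  assume h: "h \<in> carrier (lin_endo K T) \<and>
    (\<forall>v\<in>carrier V. \<forall>w\<in>carrier W. h (tens K V W v w) = \<beta> v w)"
    and h': "h' \<in> carrier (lin_endo K T) \<and>
    (\<forall>v\<in>carrier V. \<forall>w\<in>carrier W. h' (tens K V W v w) = \<beta> v w)"
  show "h = h'"
  proof (rule extensionalityI)
    show "h t = h' t" if "t \<in> carrier T" for t
      by (rule tens_hom_eq[OF T.module_axioms _ _ _ that])
         (use h h' in \<open>simp_all add: lin_endo_carrier\<close>)
  qed (use h h' in \<open>simp_all add: lin_endo_carrier\<close>)
qed

section \<open>The threefold tensor product\<close>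

locale tensor_cube = field K + V: module K V for K (structure) and V
begin

abbreviation "VV \<equiv> tensor K V V"

sublocale VV: tensor_product K V V ..
sublocale VV_V: tensor_product K VV V ..
sublocale V_VV: tensor_product K V VV ..

definition tens3 where "tens3 u v w = tens K VV V (tens K V V u v) w"

lemma tens3_closed:
  "\<lbrakk>u \<in> carrier V; v \<in> carrier V; w \<in> carrier V\<rbrakk> \<Longrightarrow> tens3 u v w \<in> carrier (tensor3 K V)"
  by (simp add: tens3_def tensor3_def VV.tens_closed VV_V.tens_closed)

lemma tensor3_module: "module K (tensor3 K V)"
  by (simp add: tensor3_def VV_V.T.module_axioms)

text \<open>The comparison on elementary tensors is used twice: first for
  \<open>s \<otimes> w\<close> with \<open>s\<close> in \<open>VV\<close>, then, with
  \<open>w\<close> fixed, for the two maps composed with the linear map sending \<open>s\<close> to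
  \<open>s \<otimes> w\<close>.\<close>

lemma tens3_hom_eq:
  assumes U: "module K U"
    and h: "h \<in> module_hom K (tensor3 K V) U" and h': "h' \<in> module_hom K (tensor3 K V) U"
    and eq: "\<And>u v w. \<lbrakk>u \<in> carrier V; v \<in> carrier V; w \<in> carrier V\<rbrakk> \<Longrightarrow> h (tens3 u v w) = h' (tens3 u v w)"
    and "t \<in> carrier (tensor3 K V)"
  shows "h t = h' t"
  using U h h' _ assms(5) unfolding tensor3_def
proof (rule VV_V.tens_hom_eq)
  fix s w assume s: "s \<in> carrier VV" and w: "w \<in> carrier V"
  note l = bilinear_map_left[OF VV_V.bilinear_map_tens w]
  show "h (tens K VV V s w) = h' (tens K VV V s w)"
    by (rule VV.tens_hom_eq[OF U module_hom_comp[OF l h[unfolded tensor3_def]]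
          module_hom_comp[OF l h'[unfolded tensor3_def]] _ s])
       (use eq w in \<open>simp add: tens3_def\<close>)
qed

section \<open>The flip and the associativity maps on elementary tensors\<close>

lemma tensor_flip_hom: "tensor_flip K V \<in> module_hom K VV VV"
  and tensor_flip_tens: "\<lbrakk>v \<in> carrier V; w \<in> carrier V\<rbrakk>
    \<Longrightarrow> tensor_flip K V (tens K V V v w) = tens K V V w v"
proof -
  note * = VV.T.module_axioms bilinear_map_swap[OF VV.bilinear_map_tens]
  show "tensor_flip K V \<in> module_hom K VV VV"
    "\<lbrakk>v \<in> carrier V; w \<in> carrier V\<rbrakk> \<Longrightarrow> tensor_flip K V (tens K V V v w) = tens K V V w v"
    unfolding tensor_flip_def by (fact VV.tensor_lift_hom[OF *] VV.tensor_lift_tens[OF *])+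
qed

text \<open>The last factor \<open>w\<close> is the linear parameter of the inner lift. The
  resulting bilinear map takes \<open>w\<close> first, and swapping its arguments gives the one in
  the definition of \<open>tensor_assoc\<close>.\<close>

lemma tensor_assoc_hom: "tensor_assoc K V \<in> module_hom K (tensor3 K V) (tensor K V VV)"
  and tensor_assoc_tens3: "\<lbrakk>u \<in> carrier V; v \<in> carrier V; w \<in> carrier V\<rbrakk>
    \<Longrightarrow> tensor_assoc K V (tens3 u v w) = tens K V VV u (tens K V V v w)"
proof -
  let ?\<beta> = "\<lambda>w u v. tens K V VV u (tens K V V v w)"
  have \<beta>: "bilinear_map K V V (tensor K V VV) (?\<beta> w)" if "w \<in> carrier V" for w
    by (rule bilinear_map_comp[OF V_VV.bilinear_map_tens module_hom_id
          bilinear_map_left[OF VV.bilinear_map_tens that]])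
  have \<beta>': "(\<lambda>w. ?\<beta> w u v) \<in> module_hom K V (tensor K V VV)"
    if "u \<in> carrier V" "v \<in> carrier V" for u v
    by (rule module_hom_comp[OF bilinear_map_right[OF VV.bilinear_map_tens that(2)]
          bilinear_map_right[OF V_VV.bilinear_map_tens that(1)]])
  note V_VV = V_VV.T.module_axioms
  note * = V_VV bilinear_map_swap[OF VV.bilinear_map_tensor_lift[OF V_VV V.module_axioms \<beta> \<beta>']]
  show "tensor_assoc K V \<in> module_hom K (tensor3 K V) (tensor K V VV)"
    unfolding tensor_assoc_def Let_def tensor3_def by (rule VV_V.tensor_lift_hom[OF *])
  assume "u \<in> carrier V" "v \<in> carrier V" "w \<in> carrier V"
  then show "tensor_assoc K V (tens3 u v w) = tens K V VV u (tens K V V v w)"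
    unfolding tensor_assoc_def Let_def tens3_def
    by (simp add: VV_V.tensor_lift_tens[OF *] VV.tens_closed VV.tensor_lift_tens[OF V_VV \<beta>])
qed

text \<open>Here the parameter is the first factor \<open>u\<close>, so the arguments are already in
  the right order.\<close>

lemma tensor_assoc_inv_hom: "tensor_assoc_inv K V \<in> module_hom K (tensor K V VV) (tensor3 K V)"
  and tensor_assoc_inv_tens: "\<lbrakk>u \<in> carrier V; v \<in> carrier V; w \<in> carrier V\<rbrakk>
    \<Longrightarrow> tensor_assoc_inv K V (tens K V VV u (tens K V V v w)) = tens3 u v w"
proof -
  let ?\<beta> = "\<lambda>u v w. tens K VV V (tens K V V u v) w"
  have \<beta>: "bilinear_map K V V (tensor K VV V) (?\<beta> u)" if "u \<in> carrier V" for u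
    by (rule bilinear_map_comp[OF VV_V.bilinear_map_tens
          bilinear_map_right[OF VV.bilinear_map_tens that] module_hom_id])
  have \<beta>': "(\<lambda>u. ?\<beta> u v w) \<in> module_hom K V (tensor K VV V)"
    if "v \<in> carrier V" "w \<in> carrier V" for v w
    by (rule module_hom_comp[OF bilinear_map_left[OF VV.bilinear_map_tens that(1)]
          bilinear_map_left[OF VV_V.bilinear_map_tens that(2)]])
  note VV_V = VV_V.T.module_axioms
  note * = VV_V VV.bilinear_map_tensor_lift[OF VV_V V.module_axioms \<beta> \<beta>']
  show "tensor_assoc_inv K V \<in> module_hom K (tensor K V VV) (tensor3 K V)"
    unfolding tensor_assoc_inv_def Let_def tensor3_def by (rule V_VV.tensor_lift_hom[OF *])
  assume "u \<in> carrier V" "v \<in> carrier V" "w \<in> carrier V"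
  then show "tensor_assoc_inv K V (tens K V VV u (tens K V V v w)) = tens3 u v w"
    unfolding tensor_assoc_inv_def Let_def tens3_def
    by (simp add: V_VV.tensor_lift_tens[OF *] VV.tens_closed VV.tensor_lift_tens[OF VV_V \<beta>])
qed

section \<open>Operators on two of the three factors\<close>

context
  fixes T assumes T: "T \<in> module_hom K VV VV"
begin

lemma op12_closed: "op12 K V T \<in> carrier (lin_endo K (tensor3 K V))"
  and op12_tens: "\<lbrakk>t \<in> carrier VV; w \<in> carrier V\<rbrakk>
    \<Longrightarrow> op12 K V T (tens K VV V t w) = tens K VV V (T t) w"
proof -
  note * = VV_V.tensor_product_axioms VV_V.tensor_product_axioms T module_hom_id
  show "op12 K V T \<in> carrier (lin_endo K (tensor3 K V))"
    unfolding lin_endo_carrier op12_def tensor3_def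
    using tensor_map_hom[OF *] tensor_map_ext[OF *] by blast
  show "\<lbrakk>t \<in> carrier VV; w \<in> carrier V\<rbrakk>
    \<Longrightarrow> op12 K V T (tens K VV V t w) = tens K VV V (T t) w"
    unfolding op12_def by (rule tensor_map_tens[OF *])
qed

text \<open>The inverse associativity map stays unevaluated, since \<open>T\<close> may send
  \<open>v \<otimes> w\<close> to an element that is not an elementary tensor.\<close>

lemma op23_closed: "op23 K V T \<in> carrier (lin_endo K (tensor3 K V))"
  and op23_tens3: "\<lbrakk>u \<in> carrier V; v \<in> carrier V; w \<in> carrier V\<rbrakk>
    \<Longrightarrow> op23 K V T (tens3 u v w) = tensor_assoc_inv K V (tens K V VV u (T (tens K V V v w)))"
proof -
  note * = V_VV.tensor_product_axioms V_VV.tensor_product_axioms module_hom_id T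
  show "op23 K V T \<in> carrier (lin_endo K (tensor3 K V))"
    unfolding lin_endo_carrier op23_def
    by (intro conjI compose_extensional
        module_hom_compose[OF V_VV.T.module_axioms _ tensor_assoc_inv_hom tensor3_module]
        module_hom_compose[OF V_VV.T.module_axioms tensor_assoc_hom tensor_map_hom[OF *] tensor3_module])
  show "\<lbrakk>u \<in> carrier V; v \<in> carrier V; w \<in> carrier V\<rbrakk>
    \<Longrightarrow> op23 K V T (tens3 u v w) = tensor_assoc_inv K V (tens K V VV u (T (tens K V V v w)))"
    by (simp add: op23_def compose_eq tens3_closed tensor_assoc_tens3 tensor_map_tens[OF *] VV.tens_closed)
qed

end

lemma op23_flip_tens3: "\<lbrakk>u \<in> carrier V; v \<in> carrier V; w \<in> carrier V\<rbrakk>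
    \<Longrightarrow> op23 K V (tensor_flip K V) (tens3 u v w) = tens3 u w v"
  by (simp add: op23_tens3[OF tensor_flip_hom] tensor_flip_tens tensor_assoc_inv_tens)

lemma op13_closed:
  assumes "T \<in> module_hom K VV VV"
  shows "op13 K V T \<in> carrier (lin_endo K (tensor3 K V))"
  unfolding op13_def Let_def
  by (intro monoid.m_closed[OF lin_endo_monoid[OF tensor3_module]]
      op23_closed[OF tensor_flip_hom] op12_closed[OF assms])

text \<open>The first flip brings \<open>w\<close> next to \<open>u\<close>, where \<open>T\<close>
  acts on the pair. The second flip stays unevaluated until the value of \<open>T\<close> is known
  as a combination of elementary tensors.\<close>

lemma op13_tens3:
  assumes "T \<in> module_hom K VV VV" "u \<in> carrier V" "v \<in> carrier V" "w \<in> carrier V"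
  shows "op13 K V T (tens3 u v w) =
    op23 K V (tensor_flip K V) (tens K VV V (T (tens K V V u w)) v)"
proof -
  have "op12 K V T (tens3 u w v) = tens K VV V (T (tens K V V u w)) v"
    using assms by (simp add: tens3_def op12_tens[OF assms(1)] VV.tens_closed)
  moreover have "T (tens K V V u w) \<in> carrier VV"
    using assms module_hom_closed[OF assms(1)] VV.tens_closed by blast
  ultimately show ?thesis
    using assms
    by (simp add: op13_def Let_def lin_endo_mult compose_eq tens3_closed op23_flip_tens3)
qed

end

section \<open>The operators of an algebra\<close>

context assoc_algebra
begin

sublocale tensor_cube K A ..

lemma mult_bilinear: "bilinear_map K A A A (\<lambda>a b. a \<otimes>\<^bsub>A\<^esub> b)"
  by (rule bilinear_mapI)
     (auto simp: module_hom_def smult_mult_left smult_mult_right l_distr r_distr)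

text \<open>A predicate instead of a chosen operator, because the theorem concerns every
  \<open>R'\<close> with these values.\<close>

definition R_op where
  "R_op x T \<longleftrightarrow> T \<in> module_hom K VV VV \<and> (\<forall>a\<in>carrier A. \<forall>b\<in>carrier A.
     T (tens K A A a b) = x \<odot>\<^bsub>VV\<^esub> tens K A A \<one>\<^bsub>A\<^esub> (a \<otimes>\<^bsub>A\<^esub> b)
       \<oplus>\<^bsub>VV\<^esub> tens K A A (a \<otimes>\<^bsub>A\<^esub> b) \<one>\<^bsub>A\<^esub> \<ominus>\<^bsub>VV\<^esub> tens K A A b a)"

text \<open>The map \<open>\<mu>\<close> is left general to cover both \<open>ab\<close>, needed for
  \<open>R'\<close>, and \<open>ba\<close>, needed for its inverse.\<close>

lemma bilinear_map_tens_one: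
  assumes "bilinear_map K A A A \<mu>"
  shows "bilinear_map K A A VV (\<lambda>a b. tens K A A \<one>\<^bsub>A\<^esub> (\<mu> a b))"
    and "bilinear_map K A A VV (\<lambda>a b. tens K A A (\<mu> a b) \<one>\<^bsub>A\<^esub>)"
  by (rule bilinear_map_hom[OF assms bilinear_map_right[OF VV.bilinear_map_tens one_closed]]
        bilinear_map_hom[OF assms bilinear_map_left[OF VV.bilinear_map_tens one_closed]])+

lemma R_op_bilinear:
  assumes "x \<in> carrier K"
  shows "bilinear_map K A A VV (\<lambda>a b. x \<odot>\<^bsub>VV\<^esub> tens K A A \<one>\<^bsub>A\<^esub> (a \<otimes>\<^bsub>A\<^esub> b)
       \<oplus>\<^bsub>VV\<^esub> tens K A A (a \<otimes>\<^bsub>A\<^esub> b) \<one>\<^bsub>A\<^esub> \<ominus>\<^bsub>VV\<^esub> tens K A A b a)"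
  by (intro bilinear_map_minus bilinear_map_plus bilinear_map_scale VV.T.module_axioms assms
      bilinear_map_tens_one mult_bilinear bilinear_map_swap[OF VV.bilinear_map_tens])

lemma R_inv_bilinear:
  assumes "y \<in> carrier K"
  shows "bilinear_map K A A VV (\<lambda>a b. tens K A A (b \<otimes>\<^bsub>A\<^esub> a) \<one>\<^bsub>A\<^esub>
       \<oplus>\<^bsub>VV\<^esub> y \<odot>\<^bsub>VV\<^esub> tens K A A \<one>\<^bsub>A\<^esub> (b \<otimes>\<^bsub>A\<^esub> a) \<ominus>\<^bsub>VV\<^esub> tens K A A b a)"
  by (intro bilinear_map_minus bilinear_map_plus bilinear_map_scale VV.T.module_axioms assms
      bilinear_map_tens_one bilinear_map_swap[OF mult_bilinear] bilinear_map_swap[OF VV.bilinear_map_tens])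

text \<open>Inserting the untouched factor is linear, and so are the maps that reorder or rebracket
  the factors. Hence each operator carries the three terms of \<open>T\<close> over to three terms
  in the triple product.\<close>

lemma R_op_tens3:
  assumes "R_op x T" "x \<in> carrier K" "a \<in> carrier A" "b \<in> carrier A" "c \<in> carrier A"
  shows op12_R: "op12 K A T (tens3 a b c) = x \<odot>\<^bsub>tensor3 K A\<^esub> tens3 \<one>\<^bsub>A\<^esub> (a \<otimes>\<^bsub>A\<^esub> b) c
      \<oplus>\<^bsub>tensor3 K A\<^esub> tens3 (a \<otimes>\<^bsub>A\<^esub> b) \<one>\<^bsub>A\<^esub> c \<ominus>\<^bsub>tensor3 K A\<^esub> tens3 b a c" (is ?R12)
    and op13_R: "op13 K A T (tens3 a b c) = x \<odot>\<^bsub>tensor3 K A\<^esub> tens3 \<one>\<^bsub>A\<^esub> b (a \<otimes>\<^bsub>A\<^esub> c)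
      \<oplus>\<^bsub>tensor3 K A\<^esub> tens3 (a \<otimes>\<^bsub>A\<^esub> c) b \<one>\<^bsub>A\<^esub> \<ominus>\<^bsub>tensor3 K A\<^esub> tens3 c b a" (is ?R13)
    and op23_R: "op23 K A T (tens3 a b c) = x \<odot>\<^bsub>tensor3 K A\<^esub> tens3 a \<one>\<^bsub>A\<^esub> (b \<otimes>\<^bsub>A\<^esub> c)
      \<oplus>\<^bsub>tensor3 K A\<^esub> tens3 a (b \<otimes>\<^bsub>A\<^esub> c) \<one>\<^bsub>A\<^esub> \<ominus>\<^bsub>tensor3 K A\<^esub> tens3 a c b" (is ?R23)
proof -
  have T: "T \<in> module_hom K VV VV"
    and val: "\<And>a b. \<lbrakk>a \<in> carrier A; b \<in> carrier A\<rbrakk> \<Longrightarrow>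
      T (tens K A A a b) = x \<odot>\<^bsub>VV\<^esub> tens K A A \<one>\<^bsub>A\<^esub> (a \<otimes>\<^bsub>A\<^esub> b)
       \<oplus>\<^bsub>VV\<^esub> tens K A A (a \<otimes>\<^bsub>A\<^esub> b) \<one>\<^bsub>A\<^esub> \<ominus>\<^bsub>VV\<^esub> tens K A A b a"
    using assms(1) by (simp_all add: R_op_def)
  have comb: "tens K VV A (x \<odot>\<^bsub>VV\<^esub> u \<oplus>\<^bsub>VV\<^esub> v \<ominus>\<^bsub>VV\<^esub> w) d =
      x \<odot>\<^bsub>tensor3 K A\<^esub> tens K VV A u d \<oplus>\<^bsub>tensor3 K A\<^esub> tens K VV A v d \<ominus>\<^bsub>tensor3 K A\<^esub> tens K VV A w d"
    if "u \<in> carrier VV" "v \<in> carrier VV" "w \<in> carrier VV" "d \<in> carrier A" for u v w d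
    unfolding tensor3_def
    by (rule module_hom_lincomb[OF VV.T.module_axioms VV_V.T.module_axioms
          bilinear_map_left[OF VV_V.bilinear_map_tens] assms(2)]) fact+
  note lin = module_hom_lincomb[OF _ tensor3_module _ assms(2)]
  show ?R12
    using assms by (simp add: tens3_def op12_tens[OF T] val comb VV.tens_closed)
  \<comment> \<open>The closing flip of \<open>op13\<close> meets a sum of three tensors, so its
    linearity is needed before it can be evaluated.\<close>
  have flip: "op23 K A (tensor_flip K A) \<in> module_hom K (tensor3 K A) (tensor3 K A)"
    using op23_closed[OF tensor_flip_hom] by (simp add: lin_endo_carrier)
  show ?R13
    using assms(2-)
    by (simp add: op13_tens3[OF T] val comb VV.tens_closed lin[OF tensor3_module flip]
        tens3_def[symmetric] tens3_closed op23_flip_tens3)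
  have "tens K A VV a (x \<odot>\<^bsub>VV\<^esub> u \<oplus>\<^bsub>VV\<^esub> v \<ominus>\<^bsub>VV\<^esub> w) =
      x \<odot>\<^bsub>tensor K A VV\<^esub> tens K A VV a u \<oplus>\<^bsub>tensor K A VV\<^esub> tens K A VV a v
        \<ominus>\<^bsub>tensor K A VV\<^esub> tens K A VV a w"
    if "u \<in> carrier VV" "v \<in> carrier VV" "w \<in> carrier VV" for u v w
    by (rule module_hom_lincomb[OF VV.T.module_axioms V_VV.T.module_axioms
          bilinear_map_right[OF V_VV.bilinear_map_tens] assms(2)]) fact+
  then show ?R23
    using assms(2-)
    by (simp add: op23_tens3[OF T] val VV.tens_closed V_VV.tens_closed
        lin[OF V_VV.T.module_axioms tensor_assoc_inv_hom] tensor_assoc_inv_tens)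
qed

text \<open>The choice \<open>\<phi> (x, z) = z\<close> appears here as the same \<open>T\<close>
  acting on factors 1,3 and on factors 2,3, while \<open>S\<close> has its own parameter
  \<open>x\<close>.\<close>

lemma R_op_yang_baxter:
  assumes x: "x \<in> carrier K" "R_op x S" and z: "z \<in> carrier K" "R_op z T"
  shows "op12 K A S \<otimes>\<^bsub>lin_endo K (tensor3 K A)\<^esub> op13 K A T
      \<otimes>\<^bsub>lin_endo K (tensor3 K A)\<^esub> op23 K A T =
    op23 K A T \<otimes>\<^bsub>lin_endo K (tensor3 K A)\<^esub> op13 K A T
      \<otimes>\<^bsub>lin_endo K (tensor3 K A)\<^esub> op12 K A S" (is "?L = ?R")
proof -
  let ?T = "tensor3 K A"
  interpret T3: module K ?T by (rule tensor3_module)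
  interpret E: monoid "lin_endo K ?T" by (rule lin_endo_monoid[OF tensor3_module])
  have ST: "S \<in> module_hom K VV VV" "T \<in> module_hom K VV VV"
    using x z by (simp_all add: R_op_def)
  note closed = op12_closed[OF ST(1)] op13_closed[OF ST(2)] op23_closed[OF ST(2)]
  note hom = closed[unfolded lin_endo_carrier, THEN conjunct1]
  note lin = hom[THEN module_hom_lincomb[OF tensor3_module tensor3_module]]
  have LR: "?L \<in> carrier (lin_endo K ?T)" "?R \<in> carrier (lin_endo K ?T)"
    using closed by simp_all
  show ?thesis
  proof (rule extensionalityI)
    show "?L \<in> extensional (carrier ?T)" "?R \<in> extensional (carrier ?T)"
      using LR by (simp_all add: lin_endo_carrier)
    fix t assume t: "t \<in> carrier ?T"
    show "?L t = ?R t"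
    proof (rule tens3_hom_eq[OF tensor3_module _ _ _ t])
      show "?L \<in> module_hom K ?T ?T" "?R \<in> module_hom K ?T ?T"
        using LR by (simp_all add: lin_endo_carrier)
      fix a b c assume abc: "a \<in> carrier A" "b \<in> carrier A" "c \<in> carrier A"
      note cl = hom[THEN module_hom_closed, THEN funcset_mem]
      have L: "?L (tens3 a b c) = op12 K A S (op13 K A T (op23 K A T (tens3 a b c)))"
        and R: "?R (tens3 a b c) = op23 K A T (op13 K A T (op12 K A S (tens3 a b c)))"
        using abc by (simp_all add: lin_endo_mult compose_eq tens3_closed cl)
      txt \<open>
        Moving the subtracted terms of each side to the other side leaves two subtraction-free
        sums of tensors scaled by products of \<open>x\<close> and \<open>z\<close>, equal up to reordering.
      \<close>
      show "?L (tens3 a b c) = ?R (tens3 a b c)"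
        unfolding L R
        using abc x z
        by (simp add: op12_R op13_R op23_R lin tens3_closed m_assoc,
            simp add: T3.a_diff_simps T3.smult_minus_right T3.smult_r_distr tens3_closed,
            simp add: tens3_closed T3.a_ac T3.smult_left_commute)
    qed
  qed
qed

text \<open>The claimed formula is bilinear in \<open>a\<close> and \<open>b\<close>, so it defines
  an operator \<open>S\<close>. Once \<open>S\<close> is a two-sided inverse of \<open>T\<close>,
  uniqueness of inverses in a monoid identifies it with \<open>inv T\<close>.\<close>

lemma R_op_inverse:
  assumes x: "x \<in> carrier K" "x \<noteq> \<zero>\<^bsub>K\<^esub>"
    and T: "R_op x T" "T \<in> carrier (lin_endo K VV)"
  shows R_op_Units: "T \<in> Units (lin_endo K VV)"
    and R_op_inv_tens: "\<lbrakk>a \<in> carrier A; b \<in> carrier A\<rbrakk> \<Longrightarrow>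
      (inv\<^bsub>lin_endo K VV\<^esub> T) (tens K A A a b) = tens K A A (b \<otimes>\<^bsub>A\<^esub> a) \<one>\<^bsub>A\<^esub>
       \<oplus>\<^bsub>VV\<^esub> (inv\<^bsub>K\<^esub> x) \<odot>\<^bsub>VV\<^esub> tens K A A \<one>\<^bsub>A\<^esub> (b \<otimes>\<^bsub>A\<^esub> a) \<ominus>\<^bsub>VV\<^esub> tens K A A b a"
proof -
  interpret E: monoid "lin_endo K VV" by (rule lin_endo_monoid[OF VV.T.module_axioms])
  define y where "y = inv\<^bsub>K\<^esub> x"
  have unit: "x \<in> Units K" using x field_Units by blast
  then have y: "y \<in> carrier K" by (simp add: y_def)
  \<comment> \<open>Here \<open>x\<close> being a unit of the field cancels the scalars
    \<open>x\<close> and \<open>1/x\<close> against each other.\<close>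
  have xy: "x \<odot>\<^bsub>VV\<^esub> (y \<odot>\<^bsub>VV\<^esub> t) = t" "y \<odot>\<^bsub>VV\<^esub> (x \<odot>\<^bsub>VV\<^esub> t) = t" if "t \<in> carrier VV" for t
    using x y unit that by (simp_all add: y_def VV.T.smult_assoc1[symmetric] Units_r_inv Units_l_inv)
  obtain S where S: "S \<in> carrier (lin_endo K VV)"
    and S_tens: "\<And>a b. \<lbrakk>a \<in> carrier A; b \<in> carrier A\<rbrakk> \<Longrightarrow> S (tens K A A a b) =
       tens K A A (b \<otimes>\<^bsub>A\<^esub> a) \<one>\<^bsub>A\<^esub>
       \<oplus>\<^bsub>VV\<^esub> y \<odot>\<^bsub>VV\<^esub> tens K A A \<one>\<^bsub>A\<^esub> (b \<otimes>\<^bsub>A\<^esub> a) \<ominus>\<^bsub>VV\<^esub> tens K A A b a"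
    using VV.lin_endo_tens_ex1[OF R_inv_bilinear[OF y]] by blast
  have T_tens: "\<And>a b. \<lbrakk>a \<in> carrier A; b \<in> carrier A\<rbrakk> \<Longrightarrow>
      T (tens K A A a b) = x \<odot>\<^bsub>VV\<^esub> tens K A A \<one>\<^bsub>A\<^esub> (a \<otimes>\<^bsub>A\<^esub> b)
       \<oplus>\<^bsub>VV\<^esub> tens K A A (a \<otimes>\<^bsub>A\<^esub> b) \<one>\<^bsub>A\<^esub> \<ominus>\<^bsub>VV\<^esub> tens K A A b a"
    using T(1) by (simp add: R_op_def)
  have ST: "S \<in> module_hom K VV VV" "T \<in> module_hom K VV VV"
    using S T by (simp_all add: lin_endo_carrier)
  \<comment> \<open>In \<open>S\<close> the scaled summand comes second, so
    \<open>module_hom_lincomb\<close> does not fit and linearity is supplied in pieces.\<close>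
  note lin = ST[THEN module_hom_diff[OF VV.T.module_axioms VV.T.module_axioms]]
    ST[THEN module_hom_add] ST[THEN module_hom_smult]
  \<comment> \<open>A composite that fixes every elementary tensor is the identity, again because
    these determine a linear map.\<close>
  have one: "P \<otimes>\<^bsub>lin_endo K VV\<^esub> Q = \<one>\<^bsub>lin_endo K VV\<^esub>"
    if PQ: "P \<in> carrier (lin_endo K VV)" "Q \<in> carrier (lin_endo K VV)"
      and eq: "\<And>a b. \<lbrakk>a \<in> carrier A; b \<in> carrier A\<rbrakk> \<Longrightarrow> P (Q (tens K A A a b)) = tens K A A a b"
    for P Q
  proof (rule extensionalityI)
    have cl: "P \<otimes>\<^bsub>lin_endo K VV\<^esub> Q \<in> carrier (lin_endo K VV)"
      "\<one>\<^bsub>lin_endo K VV\<^esub> \<in> carrier (lin_endo K VV)"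
      using PQ by simp_all
    then show "P \<otimes>\<^bsub>lin_endo K VV\<^esub> Q \<in> extensional (carrier VV)"
      "\<one>\<^bsub>lin_endo K VV\<^esub> \<in> extensional (carrier VV)"
      by (simp_all add: lin_endo_carrier)
    fix t assume t: "t \<in> carrier VV"
    show "(P \<otimes>\<^bsub>lin_endo K VV\<^esub> Q) t = \<one>\<^bsub>lin_endo K VV\<^esub> t"
    proof (rule VV.tens_hom_eq[OF VV.T.module_axioms _ _ _ t])
      fix a b assume "a \<in> carrier A" "b \<in> carrier A"
      then show "(P \<otimes>\<^bsub>lin_endo K VV\<^esub> Q) (tens K A A a b) = \<one>\<^bsub>lin_endo K VV\<^esub> (tens K A A a b)"
        using eq by (simp add: lin_endo_def compose_eq VV.tens_closed)
    qed (use cl in \<open>simp_all add: lin_endo_carrier\<close>)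
  qed
  \<comment> \<open>Since \<open>S (1 \<otimes> ab) = y (1 \<otimes> ab)\<close>, the scaled term of
    \<open>T (a \<otimes> b)\<close> returns \<open>1 \<otimes> ab\<close>. This cancels the
    subtracted term of \<open>S (ab \<otimes> 1)\<close>, and \<open>- S (b \<otimes> a)\<close>
    removes all the rest except \<open>a \<otimes> b\<close>.\<close>
  have "S \<otimes>\<^bsub>lin_endo K VV\<^esub> T = \<one>\<^bsub>lin_endo K VV\<^esub>"
  proof (rule one[OF S T(2)])
    fix a b assume "a \<in> carrier A" "b \<in> carrier A"
    then show "S (T (tens K A A a b)) = tens K A A a b"
      using x y
      by (simp add: T_tens S_tens lin VV.tens_closed,
          simp add: VV.T.a_diff_simps VV.T.smult_minus_right VV.T.smult_r_distr VV.tens_closed xy,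
          simp add: VV.T.a_ac VV.tens_closed)
  qed
  \<comment> \<open>Symmetrically, \<open>T (1 \<otimes> ba) = x (1 \<otimes> ba)\<close>, and
    scaling by \<open>y\<close> leaves the \<open>1 \<otimes> ba\<close> that
    \<open>T (ba \<otimes> 1)\<close> subtracts.\<close>
  moreover have "T \<otimes>\<^bsub>lin_endo K VV\<^esub> S = \<one>\<^bsub>lin_endo K VV\<^esub>"
  proof (rule one[OF T(2) S])
    fix a b assume "a \<in> carrier A" "b \<in> carrier A"
    then show "T (S (tens K A A a b)) = tens K A A a b"
      using x y
      by (simp add: T_tens S_tens lin VV.tens_closed,
          simp add: VV.T.a_diff_simps VV.T.smult_minus_right VV.T.smult_r_distr VV.tens_closed xy,
          simp add: VV.T.a_ac VV.tens_closed)
  qed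
  ultimately have "S = inv\<^bsub>lin_endo K VV\<^esub> T" "T \<in> Units (lin_endo K VV)"
    using S T(2) E.inv_unique'[OF T(2) S] unfolding Units_def by blast+
  then show "T \<in> Units (lin_endo K VV)"
    "\<lbrakk>a \<in> carrier A; b \<in> carrier A\<rbrakk> \<Longrightarrow>
      (inv\<^bsub>lin_endo K VV\<^esub> T) (tens K A A a b) = tens K A A (b \<otimes>\<^bsub>A\<^esub> a) \<one>\<^bsub>A\<^esub>
       \<oplus>\<^bsub>VV\<^esub> (inv\<^bsub>K\<^esub> x) \<odot>\<^bsub>VV\<^esub> tens K A A \<one>\<^bsub>A\<^esub> (b \<otimes>\<^bsub>A\<^esub> a) \<ominus>\<^bsub>VV\<^esub> tens K A A b a"
    using S_tens by (simp_all add: y_def)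
qed

end

text \<open>The formula prescribes \<open>R'\<close> on elementary tensors only, so the statement
  includes that exactly one family of linear operators on \<open>X\<close> has these values.\<close>

theorem proposition4p3:
  fixes K :: "('k, 'm) ring_scheme"
    and A :: "('k, 'a, 'n) module_scheme"
    and X :: "'k set"
    and Z :: "('k \<times> 'k) set"
    and \<phi> :: "'k \<times> 'k \<Rightarrow> 'k"
  assumes "field K"
    and "X \<subseteq> carrier K"
    and "Z \<subseteq> X \<times> X"
    and "\<And>x z. (x, z) \<in> Z \<Longrightarrow> \<phi> (x, z) = z"
    and "assoc_algebra K A"
    and "vectorspace.fin_dim K A"
  defines "AA \<equiv> tensor K A A"
    and "is_R' \<equiv> \<lambda>R'. \<forall>x\<in>X. \<forall>a\<in>carrier A. \<forall>b\<in>carrier A.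
        R' x (tens K A A a b) =
          x \<odot>\<^bsub>tensor K A A\<^esub> tens K A A \<one>\<^bsub>A\<^esub> (a \<otimes>\<^bsub>A\<^esub> b)
            \<oplus>\<^bsub>tensor K A A\<^esub> tens K A A (a \<otimes>\<^bsub>A\<^esub> b) \<one>\<^bsub>A\<^esub>
            \<ominus>\<^bsub>tensor K A A\<^esub> tens K A A b a"
  shows "(\<exists>!R'. R' \<in> X \<rightarrow>\<^sub>E carrier (lin_endo K AA) \<and> is_R' R') \<and>
    (\<forall>R' \<in> X \<rightarrow>\<^sub>E carrier (lin_endo K AA). is_R' R' \<longrightarrow>
      one_param_yang_baxter K X Z \<phi> A R' \<and>
      (\<forall>x\<in>X. x \<noteq> \<zero>\<^bsub>K\<^esub> \<longrightarrow>
        R' x \<in> Units (lin_endo K AA) \<and>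
        (\<forall>a\<in>carrier A. \<forall>b\<in>carrier A.
          (inv\<^bsub>lin_endo K AA\<^esub> (R' x)) (tens K A A a b) =
            tens K A A (b \<otimes>\<^bsub>A\<^esub> a) \<one>\<^bsub>A\<^esub>
              \<oplus>\<^bsub>AA\<^esub> (inv\<^bsub>K\<^esub> x) \<odot>\<^bsub>AA\<^esub> tens K A A \<one>\<^bsub>A\<^esub> (b \<otimes>\<^bsub>A\<^esub> a)
              \<ominus>\<^bsub>AA\<^esub> tens K A A b a)))"
proof -
  interpret assoc_algebra K A by fact
  have X: "x \<in> carrier K" if "x \<in> X" for x using assms(2) that by blast
  let ?\<beta> = "\<lambda>x a b. x \<odot>\<^bsub>VV\<^esub> tens K A A \<one>\<^bsub>A\<^esub> (a \<otimes>\<^bsub>A\<^esub> b)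
       \<oplus>\<^bsub>VV\<^esub> tens K A A (a \<otimes>\<^bsub>A\<^esub> b) \<one>\<^bsub>A\<^esub> \<ominus>\<^bsub>VV\<^esub> tens K A A b a"
  let ?P = "\<lambda>x h. h \<in> carrier (lin_endo K AA) \<and>
    (\<forall>a\<in>carrier A. \<forall>b\<in>carrier A. h (tens K A A a b) = ?\<beta> x a b)"
  have ex1: "\<exists>!h. ?P x h" if "x \<in> X" for x
    unfolding AA_def by (rule VV.lin_endo_tens_ex1[OF R_op_bilinear[OF X[OF that]]])
  have "\<exists>!R'. R' \<in> X \<rightarrow>\<^sub>E carrier (lin_endo K AA) \<and> is_R' R'"
  proof (rule ex_ex1I)
    \<comment> \<open>The operators are unique for each \<open>x\<close>, so the family is given by
      description and restricted to \<open>X\<close>, as \<open>PiE\<close> demands.\<close>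
    have "\<forall>x\<in>X. ?P x (THE h. ?P x h)" using theI'[OF ex1] by blast
    then show "\<exists>R'. R' \<in> X \<rightarrow>\<^sub>E carrier (lin_endo K AA) \<and> is_R' R'"
      unfolding is_R'_def by (intro exI[of _ "\<lambda>x\<in>X. THE h. ?P x h"]) auto
  next
    fix R R'
    assume R: "R \<in> X \<rightarrow>\<^sub>E carrier (lin_endo K AA) \<and> is_R' R"
      and R': "R' \<in> X \<rightarrow>\<^sub>E carrier (lin_endo K AA) \<and> is_R' R'"
    show "R = R'"
    proof (rule PiE_ext[OF conjunct1[OF R] conjunct1[OF R']])
      fix x assume x: "x \<in> X"
      have "?P x (R x)" "?P x (R' x)"
        using R R' x unfolding is_R'_def by (auto dest: PiE_mem)
      then show "R x = R' x" using ex1[OF x] by blast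
    qed
  qed
  moreover have "one_param_yang_baxter K X Z \<phi> A R' \<and>
      (\<forall>x\<in>X. x \<noteq> \<zero>\<^bsub>K\<^esub> \<longrightarrow>
        R' x \<in> Units (lin_endo K AA) \<and>
        (\<forall>a\<in>carrier A. \<forall>b\<in>carrier A.
          (inv\<^bsub>lin_endo K AA\<^esub> (R' x)) (tens K A A a b) =
            tens K A A (b \<otimes>\<^bsub>A\<^esub> a) \<one>\<^bsub>A\<^esub>
              \<oplus>\<^bsub>AA\<^esub> (inv\<^bsub>K\<^esub> x) \<odot>\<^bsub>AA\<^esub> tens K A A \<one>\<^bsub>A\<^esub> (b \<otimes>\<^bsub>A\<^esub> a)
              \<ominus>\<^bsub>AA\<^esub> tens K A A b a))"
    if R': "R' \<in> X \<rightarrow>\<^sub>E carrier (lin_endo K AA)" "is_R' R'" for R'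
  proof -
    have carr: "R' x \<in> carrier (lin_endo K VV)" if "x \<in> X" for x
      using PiE_mem[OF R'(1) that] by (simp add: AA_def)
    have R_op: "R_op x (R' x)" if "x \<in> X" for x
      using carr[OF that] R'(2) that by (simp add: R_op_def lin_endo_carrier is_R'_def)
    have "one_param_yang_baxter K X Z \<phi> A R'"
      unfolding one_param_yang_baxter_def
    proof (intro conjI ballI)
      show "\<phi> \<in> Z \<rightarrow> X" using assms(3,4) by fastforce
      show "vectorspace K A" ..
      fix p assume "p \<in> Z"
      then obtain x z where p: "p = (x, z)" "(x, z) \<in> Z" by (cases p) auto
      then have xz: "x \<in> X" "z \<in> X" using assms(3) by auto
      show "case p of (x, z) \<Rightarrow>
          op12 K A (R' x) \<otimes>\<^bsub>lin_endo K (tensor3 K A)\<^esub> op13 K A (R' (\<phi> (x, z)))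
            \<otimes>\<^bsub>lin_endo K (tensor3 K A)\<^esub> op23 K A (R' z) =
          op23 K A (R' z) \<otimes>\<^bsub>lin_endo K (tensor3 K A)\<^esub> op13 K A (R' (\<phi> (x, z)))
            \<otimes>\<^bsub>lin_endo K (tensor3 K A)\<^esub> op12 K A (R' x)"
        \<comment> \<open>Rewriting \<open>\<phi> (x, z)\<close> to \<open>z\<close> makes the
          middle operator \<open>R' z\<close>, the one that also acts on factors 2,3.\<close>
        using R_op_yang_baxter[OF X[OF xz(1)] R_op[OF xz(1)] X[OF xz(2)] R_op[OF xz(2)]]
        by (simp add: p assms(4))
    qed (use assms(3,6) carr in auto)
    then show ?thesis
      using R_op_Units[OF X _ R_op carr] R_op_inv_tens[OF X _ R_op carr]
      by (simp add: AA_def)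
  qed
  ultimately show ?thesis by blast
qed

end
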